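(* Let $\pi : \Omega \to M$ be an affine $d$-dimensional tori bundle over a manifold $M$. Let $(g_t)_{t\in\mathbb{R}}$ be a compatible flow on $\Omega$, with associated local velocity functions $v$, and let $\mu$ be an absolutely continuous compatible probability measure on $\Omega$. If $$\mathrm{Leb}\Big(\bigcup_{\xi \in \mathbb{Z}^d\setminus\{0\}} \{ \mathrm{d}\langle \xi, v\rangle = 0\}\Big) = 0 \quad\text{on } M,$$ then the dynamical system $(\Omega,\mu,(g_t)_{t\in\mathbb{R}})$ exhibits Keplerian shear.
   Context: Affine tori bundle: a $\mathcal{C}^1$ manifold $\Omega$ together with integers $n,d\ge 1$, an $n$-dimensional $\mathcal{C}^1$ real manifold $M$, a $\mathcal{C}^1$ projection $\pi:\Omega\to M$, and a maximal atlas $\mathcal{A}$ on $M$ (maximal among atlases trivializing the bundle in the following sense) such that for every $U\in\mathcal{A}$ there is a diffeomorphism $\psi_U:\pi^{-1}(U)\to U\times\mathbb{T}^d$ with $\pi_1\circ\psi_U=\pi$ ($\pi_1$ the first projection), the changes of charts being of the form $\psi_V\circ\psi_U^{-1}(x,y)=(x,\alpha_{U,V}(x)+A_{U,V}(y))$ on $(U\cap V)\times\mathbb{T}^d$, with $\alpha_{U,V}$ a $\mathcal{C}^1$ map $U\cap V\to\mathbb{T}^d$ and $A_{U,V}\in\mathrm{GL}_d(\mathbb{Z})$. Here $\mathbb{T}^d=\mathbb{R}^d/\mathbb{Z}^d$. Compatible flow: a flow $(g_t)$ on $\Omega$ such that for every chart $\psi_U$ there is $v_{\psi_U}\in\mathcal{C}^1(U,\mathbb{R}^d)$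 with $\psi_U\circ g_t\circ\psi_U^{-1}(x,y)=(x,y+tv_{\psi_U}(x))$ for all $t\in\mathbb{R}$. Under change of charts $v_{\psi_V}=A_{U,V}v_{\psi_U}$ on $U\cap V$, so the family of functions $\{x\mapsto\langle\xi,v(x)\rangle\}_{\xi\in\mathbb{Z}^d\setminus\{0\}}$ (computed in any chart) and hence the set $\bigcup_{\xi\ne0}\{\mathrm{d}\langle\xi,v\rangle=0\}\subset M$ are well defined. Compatible measure: a $\sigma$-finite measure $\mu$ on $\Omega$ such that for every chart $\psi_U$, $(\psi_U)_*\mu_{|\pi^{-1}(U)}=(\pi_*\mu)_{|U}\otimes\mathrm{Leb}_{\mathbb{T}^d}$. Compatible measures are invariant under compatible flows. On a $\mathcal{C}^1$ manifold, "$\mathrm{Leb}(A)=0$" means $A$ has zero Lebesgue measure in charts, and "absolutely continuous" means $\mu\ll\mathrm{Leb}$ in this sense. Keplerian shear: a flow $(\Omega,\mu,(g_t)_{t\in\mathbb{R}})$ preserving a probability measure $\mu$ exhibits Keplerian shear if for all $f\in\mathbb{L}^2(\Omega,\mu)$, $f\circ g_t\to\mathbb{E}_\mu(f\mid\mathcal{I})$ as $t\to+\infty$, weakly in $\mathbb{L}^2(\Omega,\mu)$, where $\mathcal{I}$ is the $\sigma$-algebra of $(g_t)$-invariant measurable sets (up to $\mu$-null sets). *)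

theory Defs
  imports "HOL-Probability.Probability"
begin

section \<open>\<open>C\<^sup>1\<close> manifolds\<close>

definition c1_on :: "('a::euclidean_space \<Rightarrow> 'b::euclidean_space) \<Rightarrow> 'a set \<Rightarrow> bool"
  where "c1_on f S \<longleftrightarrow>
    (\<exists>f' :: 'a \<Rightarrow> 'a \<Rightarrow>\<^sub>L 'b.
      (\<forall>x\<in>S. (f has_derivative blinfun_apply (f' x)) (at x)) \<and> continuous_on S f')"

text \<open>A chart is a pair of a domain and a map; the values of the map outside the domain carry
  no meaning.\<close>

type_synonym ('a, 'e) chart = "'a set \<times> ('a \<Rightarrow> 'e)"

text \<open>A \<open>C\<^sup>1\<close> manifold is a Hausdorff, second countable type together with an atlas, which need not be
  maximal: the notions below depend only on the maximal atlas that it generates. The dimension is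
  that of the model space.\<close>

definition c1_atlas :: "('a::topological_space, 'e::euclidean_space) chart set \<Rightarrow> bool"
  where "c1_atlas \<A> \<longleftrightarrow>
    (\<forall>(U, \<phi>)\<in>\<A>. open U \<and> open (\<phi> ` U) \<and> homeomorphism U (\<phi> ` U) \<phi> (inv_into U \<phi>)) \<and>
    (\<Union>(U, \<phi>)\<in>\<A>. U) = UNIV \<and>
    (\<forall>(U, \<phi>)\<in>\<A>. \<forall>(V, \<eta>)\<in>\<A>. c1_on (\<eta> \<circ> inv_into U \<phi>) (\<phi> ` (U \<inter> V)))"

definition chart_domain ::
    "('a::topological_space, 'e::euclidean_space) chart set \<Rightarrow> 'a set \<Rightarrow> bool"
  where "chart_domain \<A> U \<longleftrightarrow> (\<exists>\<phi>. c1_atlas (insert (U, \<phi>) \<A>))"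

text \<open>Meant for maps on an open set \<open>S\<close>.\<close>

definition c1_map_on ::
    "('a::topological_space, 'e::euclidean_space) chart set \<Rightarrow>
     ('b::topological_space, 'f::euclidean_space) chart set \<Rightarrow> 'a set \<Rightarrow> ('a \<Rightarrow> 'b) \<Rightarrow> bool"
  where "c1_map_on \<A> \<B> S f \<longleftrightarrow>
    continuous_on S f \<and>
    (\<forall>(U, \<phi>)\<in>\<A>. \<forall>(V, \<eta>)\<in>\<B>.
      c1_on (\<eta> \<circ> f \<circ> inv_into U \<phi>) (\<phi> ` (S \<inter> U \<inter> f -` V)))"

definition c1_diffeomorphism ::
    "('a::topological_space, 'e::euclidean_space) chart set \<Rightarrow>
     ('b::topological_space, 'f::euclidean_space) chart set \<Rightarrow>
     'a set \<Rightarrow> 'b set \<Rightarrow> ('a \<Rightarrow> 'b) \<Rightarrow> bool"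
  where "c1_diffeomorphism \<A> \<B> S T f \<longleftrightarrow>
    bij_betw f S T \<and> c1_map_on \<A> \<B> S f \<and> c1_map_on \<B> \<A> T (inv_into S f)"

definition euclidean_atlas :: "('e::euclidean_space, 'e) chart set"
  where "euclidean_atlas = {(UNIV, id)}"

definition prod_atlas ::
    "('a::topological_space, 'e::euclidean_space) chart set \<Rightarrow>
     ('b::topological_space, 'f::euclidean_space) chart set \<Rightarrow> ('a \<times> 'b, 'e \<times> 'f) chart set"
  where "prod_atlas \<A> \<B> = {(U \<times> V, map_prod \<phi> \<eta>) |U \<phi> V \<eta>. (U, \<phi>) \<in> \<A> \<and> (V, \<eta>) \<in> \<B>}"

definition differential_vanishes ::
    "('a::topological_space, 'e::euclidean_space) chart set \<Rightarrow> ('a \<Rightarrow> real) \<Rightarrow> 'a \<Rightarrow> bool"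
  where "differential_vanishes \<A> f x \<longleftrightarrow>
    (\<forall>(U, \<phi>)\<in>\<A>. x \<in> U \<longrightarrow> ((f \<circ> inv_into U \<phi>) has_derivative (\<lambda>_. 0)) (at (\<phi> x)))"

definition manifold_null_set ::
    "('a::topological_space, 'e::euclidean_space) chart set \<Rightarrow> 'a set \<Rightarrow> bool"
  where "manifold_null_set \<A> S \<longleftrightarrow> (\<forall>(U, \<phi>)\<in>\<A>. \<phi> ` (S \<inter> U) \<in> null_sets lebesgue)"

definition manifold_absolutely_continuous ::
    "('a::topological_space, 'e::euclidean_space) chart set \<Rightarrow> 'a measure \<Rightarrow> bool"
  where "manifold_absolutely_continuous \<A> \<mu> \<longleftrightarrow>
    (\<forall>S\<in>sets borel. manifold_null_set \<A> S \<longrightarrow> S \<in> null_sets \<mu>)"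


section \<open>The torus\<close>

definition of_int_vec :: "int ^ 'd \<Rightarrow> real ^ 'd"
  where "of_int_vec k = (\<chi> i. real_of_int (k $ i))"

definition of_int_mat :: "int ^ 'd ^ 'd \<Rightarrow> real ^ 'd ^ 'd"
  where "of_int_mat A = (\<chi> i j. real_of_int (A $ i $ j))"

lemma of_int_vec_simps:
  "of_int_vec 0 = 0"
  "of_int_vec (k + l) = of_int_vec k + of_int_vec l"
  "of_int_vec (k - l) = of_int_vec k - of_int_vec l"
  "of_int_vec (- k) = - of_int_vec k"
  "of_int_vec (A *v k) = of_int_mat A *v of_int_vec k"
  by (simp_all add: of_int_vec_def of_int_mat_def vec_eq_iff matrix_vector_mult_def)

definition torus_rel :: "real ^ 'd \<Rightarrow> real ^ 'd \<Rightarrow> bool"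
  where "torus_rel x y \<longleftrightarrow> x - y \<in> range of_int_vec"

quotient_type 'd torus = "real ^ 'd::finite" / torus_rel
  morphisms rep_torus torus_proj
proof (intro equivpI reflpI sympI transpI)
  fix x y z :: "real ^ 'd"
  show "torus_rel x x"
    unfolding torus_rel_def using of_int_vec_simps(1) by (metis cancel_comm_monoid_add_class.diff_cancel rangeI)
  show "torus_rel y x" if "torus_rel x y"
    using that unfolding torus_rel_def by (metis (no_types, lifting) imageE minus_diff_eq of_int_vec_simps(4) rangeI)
  show "torus_rel x z" if "torus_rel x y" "torus_rel y z"
  proof -
    from that obtain k l where "x - y = of_int_vec k" "y - z = of_int_vec l"
      unfolding torus_rel_def by blast
    hence "x - z = of_int_vec (k + l)" by (simp add: of_int_vec_simps algebra_simps)
    thus ?thesis unfolding torus_rel_def by blast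
  qed
qed

instantiation torus :: (finite) ab_group_add
begin

lift_definition zero_torus :: "'a torus" is "0" .

lift_definition plus_torus :: "'a torus \<Rightarrow> 'a torus \<Rightarrow> 'a torus" is "(+)"
proof -
  fix x x' y y' :: "real ^ 'a"
  assume "torus_rel x x'" "torus_rel y y'"
  then obtain k l where "x - x' = of_int_vec k" "y - y' = of_int_vec l"
    unfolding torus_rel_def by blast
  hence "(x + y) - (x' + y') = of_int_vec (k + l)"
    by (simp add: of_int_vec_simps algebra_simps)
  thus "torus_rel (x + y) (x' + y')" unfolding torus_rel_def by blast
qed

lift_definition uminus_torus :: "'a torus \<Rightarrow> 'a torus" is uminus
proof -
  fix x x' :: "real ^ 'a"
  assume "torus_rel x x'"
  then obtain k where "x - x' = of_int_vec k"
    unfolding torus_rel_def by blast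
  hence "- x - - x' = of_int_vec (- k)"
    by (simp add: of_int_vec_simps algebra_simps)
  thus "torus_rel (- x) (- x')" unfolding torus_rel_def by blast
qed

definition minus_torus :: "'a torus \<Rightarrow> 'a torus \<Rightarrow> 'a torus"
  where "minus_torus x y = x + - y"

instance
proof -
  have [simp]: "torus_rel x x" for x :: "real ^ 'a"
    using equivp_reflp[OF torus_equivp] .
  show "OFCLASS('a torus, ab_group_add_class)"
    by standard (transfer; simp add: minus_torus_def algebra_simps)+
qed

end

instantiation torus :: (finite) topological_space
begin

definition open_torus :: "'a torus set \<Rightarrow> bool"
  where "open_torus U \<longleftrightarrow> open (torus_proj -` U)"

instance
  by standard (auto simp: open_torus_def vimage_Union)

end

text \<open>The charts are the local inverses of the covering \<open>\<real>\<^sup>d \<rightarrow> \<real>\<^sup>d / \<int>\<^sup>d\<close>.\<close>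

definition torus_atlas :: "('d::finite torus, real ^ 'd) chart set"
  where "torus_atlas = {(torus_proj ` B, inv_into B torus_proj) |B. open B \<and> inj_on torus_proj B}"

lift_definition torus_linear :: "int ^ 'd ^ 'd \<Rightarrow> 'd::finite torus \<Rightarrow> 'd torus"
  is "\<lambda>A x. of_int_mat A *v x"
proof -
  fix A :: "int ^ 'd ^ 'd" and x y :: "real ^ 'd"
  assume "torus_rel x y"
  then obtain k where "x - y = of_int_vec k" unfolding torus_rel_def by blast
  hence "of_int_mat A *v x - of_int_mat A *v y = of_int_vec (A *v k)"
    by (simp add: of_int_vec_simps flip: matrix_vector_mult_diff_distrib)
  thus "torus_rel (of_int_mat A *v x) (of_int_mat A *v y)" unfolding torus_rel_def by blast
qed

definition torus_lebesgue :: "'d::finite torus measure"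
  where "torus_lebesgue =
    distr (restrict_space lborel {x :: real ^ 'd. \<forall>i. 0 \<le> x $ i \<and> x $ i < 1}) borel torus_proj"


section \<open>Affine tori bundles\<close>

text \<open>A trivialization is a pair \<open>(U, \<psi>)\<close> of a chart domain \<open>U\<close> of the base and a map \<open>\<psi>\<close> that
  matters only on \<open>\<pi>\<^sup>-\<^sup>1(U)\<close>; an atlas may contain several maps over the same \<open>U\<close>.\<close>

type_synonym ('o, 'm, 'd) trivialization = "'m set \<times> ('o \<Rightarrow> 'm \<times> 'd torus)"

definition local_trivialization ::
    "('o::topological_space, 'e::euclidean_space) chart set \<Rightarrow>
     ('m::topological_space, real ^ 'n) chart set \<Rightarrow> ('o \<Rightarrow> 'm) \<Rightarrow>
     ('o, 'm, 'd::finite) trivialization \<Rightarrow> bool"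
  where "local_trivialization \<A>\<^sub>\<Omega> \<A>\<^sub>M \<pi> = (\<lambda>(U, \<psi>).
    chart_domain \<A>\<^sub>M U \<and>
    c1_diffeomorphism \<A>\<^sub>\<Omega> (prod_atlas \<A>\<^sub>M torus_atlas) (\<pi> -` U) (U \<times> UNIV) \<psi> \<and>
    (\<forall>z\<in>\<pi> -` U. fst (\<psi> z) = \<pi> z))"

text \<open>Invertibility of \<open>A\<close> is over the integers, that is, \<open>A\<close> is in \<open>GL\<^sub>d(\<int>)\<close>.\<close>

definition affine_change_of_charts ::
    "('m::topological_space, real ^ 'n) chart set \<Rightarrow> ('o \<Rightarrow> 'm) \<Rightarrow>
     ('o, 'm, 'd::finite) trivialization \<Rightarrow> ('o, 'm, 'd) trivialization \<Rightarrow> bool"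
  where "affine_change_of_charts \<A>\<^sub>M \<pi> = (\<lambda>(U, \<psi>) (V, \<eta>).
    \<exists>\<alpha> (A :: int ^ 'd ^ 'd).
      c1_map_on \<A>\<^sub>M torus_atlas (U \<inter> V) \<alpha> \<and> invertible A \<and>
      (\<forall>x\<in>U \<inter> V. \<forall>y. \<eta> (inv_into (\<pi> -` U) \<psi> (x, y)) = (x, \<alpha> x + torus_linear A y)))"

definition trivializing_atlas ::
    "('o::topological_space, 'e::euclidean_space) chart set \<Rightarrow>
     ('m::topological_space, real ^ 'n) chart set \<Rightarrow> ('o \<Rightarrow> 'm) \<Rightarrow>
     ('o, 'm, 'd::finite) trivialization set \<Rightarrow> bool"
  where "trivializing_atlas \<A>\<^sub>\<Omega> \<A>\<^sub>M \<pi> \<T> \<longleftrightarrow>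
    (\<forall>c\<in>\<T>. local_trivialization \<A>\<^sub>\<Omega> \<A>\<^sub>M \<pi> c) \<and>
    (\<Union>(U, \<psi>)\<in>\<T>. U) = UNIV \<and>
    (\<forall>c\<in>\<T>. \<forall>c'\<in>\<T>. affine_change_of_charts \<A>\<^sub>M \<pi> c c')"

definition affine_tori_bundle ::
    "('o::{t2_space, second_countable_topology}, 'e::euclidean_space) chart set \<Rightarrow>
     ('m::{t2_space, second_countable_topology}, real ^ 'n) chart set \<Rightarrow> ('o \<Rightarrow> 'm) \<Rightarrow>
     ('o, 'm, 'd::finite) trivialization set \<Rightarrow> bool"
  where "affine_tori_bundle \<A>\<^sub>\<Omega> \<A>\<^sub>M \<pi> \<T> \<longleftrightarrow>
    c1_atlas \<A>\<^sub>\<Omega> \<and> c1_atlas \<A>\<^sub>M \<and> c1_map_on \<A>\<^sub>\<Omega> \<A>\<^sub>M UNIV \<pi> \<and> surj \<pi> \<and>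
    trivializing_atlas \<A>\<^sub>\<Omega> \<A>\<^sub>M \<pi> \<T> \<and>
    (\<forall>\<T>'. trivializing_atlas \<A>\<^sub>\<Omega> \<A>\<^sub>M \<pi> \<T>' \<and> \<T> \<subseteq> \<T>' \<longrightarrow> \<T>' = \<T>)"

definition is_flow :: "(real \<Rightarrow> 'o \<Rightarrow> 'o) \<Rightarrow> bool"
  where "is_flow g \<longleftrightarrow> g 0 = id \<and> (\<forall>s t. g (s + t) = g s \<circ> g t)"

text \<open>The flow determines the velocity functions \<open>v (U, \<psi>)\<close> on \<open>U\<close>. Since \<open>\<psi>\<close> is
  meaningful on \<open>\<pi>\<^sup>-\<^sup>1(U)\<close> only, invariance of this set under the flow is spelled out.\<close>

definition compatible_flow ::
    "('m::topological_space, real ^ 'n) chart set \<Rightarrow> ('o \<Rightarrow> 'm) \<Rightarrow>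
     ('o, 'm, 'd::finite) trivialization set \<Rightarrow> (real \<Rightarrow> 'o \<Rightarrow> 'o) \<Rightarrow>
     (('o, 'm, 'd) trivialization \<Rightarrow> 'm \<Rightarrow> real ^ 'd) \<Rightarrow> bool"
  where "compatible_flow \<A>\<^sub>M \<pi> \<T> g v \<longleftrightarrow>
    is_flow g \<and>
    (\<forall>(U, \<psi>)\<in>\<T>.
      c1_map_on \<A>\<^sub>M euclidean_atlas U (v (U, \<psi>)) \<and>
      (\<forall>t. g t ` (\<pi> -` U) \<subseteq> \<pi> -` U) \<and>
      (\<forall>t. \<forall>x\<in>U. \<forall>y.
        \<psi> (g t (inv_into (\<pi> -` U) \<psi> (x, y))) = (x, y + torus_proj (t *\<^sub>R v (U, \<psi>) x))))"

text \<open>By the change of charts \<open>v\<^sub>V = A v\<^sub>U\<close> the union over \<open>\<xi>\<close> does not depend on the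
  trivialization used at \<open>x\<close>.\<close>

definition resonant_set ::
    "('m::topological_space, real ^ 'n) chart set \<Rightarrow> ('o, 'm, 'd::finite) trivialization set \<Rightarrow>
     (('o, 'm, 'd) trivialization \<Rightarrow> 'm \<Rightarrow> real ^ 'd) \<Rightarrow> 'm set"
  where "resonant_set \<A>\<^sub>M \<T> v =
    (\<Union>\<xi>\<in>UNIV - {0 :: int ^ 'd}.
      {x. \<exists>(U, \<psi>)\<in>\<T>. x \<in> U \<and>
            differential_vanishes \<A>\<^sub>M (\<lambda>z. inner (of_int_vec \<xi>) (v (U, \<psi>) z)) x})"

definition compatible_measure ::
    "('o::topological_space \<Rightarrow> 'm::topological_space) \<Rightarrow> ('o, 'm, 'd::finite) trivialization set \<Rightarrow>
     'o measure \<Rightarrow> bool"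
  where "compatible_measure \<pi> \<T> \<mu> \<longleftrightarrow>
    sets \<mu> = sets borel \<and> sigma_finite_measure \<mu> \<and>
    (\<forall>(U, \<psi>)\<in>\<T>.
      distr (restrict_space \<mu> (\<pi> -` U)) (restrict_space borel U \<Otimes>\<^sub>M torus_lebesgue) \<psi> =
      restrict_space (distr \<mu> borel \<pi>) U \<Otimes>\<^sub>M torus_lebesgue)"


section \<open>Keplerian shear\<close>

definition L2 :: "'a measure \<Rightarrow> ('a \<Rightarrow> real) set"
  where "L2 \<mu> = {f \<in> borel_measurable \<mu>. integrable \<mu> (\<lambda>x. (f x)\<^sup>2)}"

definition weakly_tendsto_L2 ::
    "'a measure \<Rightarrow> ('i \<Rightarrow> 'a \<Rightarrow> real) \<Rightarrow> ('a \<Rightarrow> real) \<Rightarrow> 'i filter \<Rightarrow> bool"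
  where "weakly_tendsto_L2 \<mu> u f F \<longleftrightarrow>
    (\<forall>i. u i \<in> L2 \<mu>) \<and> f \<in> L2 \<mu> \<and>
    (\<forall>h\<in>L2 \<mu>. ((\<lambda>i. \<integral>x. u i x * h x \<partial>\<mu>) \<longlongrightarrow> (\<integral>x. f x * h x \<partial>\<mu>)) F)"

definition preserves_measure :: "'a measure \<Rightarrow> (real \<Rightarrow> 'a \<Rightarrow> 'a) \<Rightarrow> bool"
  where "preserves_measure \<mu> g \<longleftrightarrow> (\<forall>t. g t \<in> measurable \<mu> \<mu> \<and> distr \<mu> \<mu> (g t) = \<mu>)"

text \<open>For a measure preserving flow the generating family is already a \<open>\<sigma>\<close>-algebra; \<^const>\<open>sigma\<close> only
  packages it as a measure space, as expected by \<^const>\<open>real_cond_exp\<close>.\<close>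

definition invariant_algebra :: "'a measure \<Rightarrow> (real \<Rightarrow> 'a \<Rightarrow> 'a) \<Rightarrow> 'a measure"
  where "invariant_algebra \<mu> g =
    sigma (space \<mu>)
      {A \<in> sets \<mu>. \<forall>t. sym_diff (g t -` A \<inter> space \<mu>) A \<in> null_sets \<mu>}"

definition keplerian_shear :: "'a measure \<Rightarrow> (real \<Rightarrow> 'a \<Rightarrow> 'a) \<Rightarrow> bool"
  where "keplerian_shear \<mu> g \<longleftrightarrow>
    prob_space \<mu> \<and> is_flow g \<and> preserves_measure \<mu> g \<and>
    (\<forall>f\<in>L2 \<mu>.
      weakly_tendsto_L2 \<mu> (\<lambda>t. f \<circ> g t) (real_cond_exp \<mu> (invariant_algebra \<mu> g) f) at_top)"

end

theory Submission imports Defs begin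

text \<open>In a trivialization \<open>(x, y) \<in> U \<times> (\<real> / \<int>)\<^sup>d\<close> the flow rotates each torus by \<open>t v(x)\<close>, so the
  function \<open>a(x) cos (2\<pi>\<langle>\<xi>, y\<rangle> + c)\<close> evolves into \<open>a(x) cos (2\<pi>\<langle>\<xi>, y\<rangle> + c + 2\<pi>t\<langle>\<xi>, v(x)\<rangle>)\<close>.
  For \<open>\<xi> = 0\<close> it is invariant. For \<open>\<xi> \<noteq> 0\<close> it should converge weakly to \<open>0\<close>, because the phase
  \<open>t\<langle>\<xi>, v(x)\<rangle>\<close> makes it oscillate faster and faster as \<open>x\<close> varies.

  The convergence to \<open>0\<close> is the Riemann--Lebesgue lemma for the law of the real random variable
  \<open>\<langle>\<xi>, v\<rangle> \<circ> \<pi>\<close> (\<open>Riemann_Lebesgue_absolutely_continuous\<close>). It asks that this law be absolutely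
  continuous, that is, that \<open>\<pi>\<^sup>-\<^sup>1{\<langle>\<xi>, v\<rangle> \<in> N}\<close> be \<open>\<mu>\<close>-null for every Lebesgue null set \<open>N\<close> of reals
  (\<open>frequency_level_null\<close>). Two geometric facts give this. First, where the differential of a
  \<open>C\<^sup>1\<close> function does not vanish, the preimage of a null set is null (\<open>null_nonsingular_preimage\<close>);
  where it vanishes, the point is resonant, and resonant points form a null set by assumption.
  Secondly, \<open>\<pi>\<close> is locally a projection of a product, so preimages under \<open>\<pi>\<close> of null sets are
  null (\<open>manifold_null_set_vimage\<close>), and \<open>\<mu>\<close> is absolutely continuous.

  It remains to pass from these waves to all of \<open>L\<^sup>2\<close> and to recognize the limit. The functions
  \<open>f\<close> for which \<open>f \<circ> g\<^sub>t\<close> tends weakly to the conditional expectation of \<open>f\<close> form a linear space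
  closed under dominated limits (\<open>relaxes_dominated_limit\<close>), since both \<open>f \<mapsto> f \<circ> g\<^sub>t\<close> and conditional
  expectation are contractions of \<open>L\<^sup>2\<close>. Whenever the weak limit exists and is measurable with
  respect to the invariant sets, it is the conditional expectation (\<open>relaxesI\<close>).
  Trigonometric polynomials approximate the indicators of open subsets of the torus
  (\<open>trig_poly_approximates_open\<close>); products of sets then
  generate the Borel sets over one chart domain, countably many chart domains cover the base, and
  simple functions finish the argument (\<open>keplerian_shearI\<close>).

  That the flow preserves \<open>\<mu>\<close> is Fubini's theorem in a trivialization together with the
  translation invariance of Lebesgue measure on the torus.\<close>

section \<open>Oscillatory integrals\<close>

lemma tendsto_by_approximation:
  fixes f :: "'i \<Rightarrow> real"
  assumes "\<And>e. 0 < e \<Longrightarrow> \<exists>g m. (g \<longlongrightarrow> m) F \<and> (\<forall>i. \<bar>f i - g i\<bar> \<le> e) \<and> \<bar>l - m\<bar> \<le> e"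
  shows "(f \<longlongrightarrow> l) F"
proof (rule tendstoI)
  fix e :: real assume "0 < e"
  then obtain g m where g: "(g \<longlongrightarrow> m) F" and fg: "\<And>i. \<bar>f i - g i\<bar> \<le> e/4" and lm: "\<bar>l - m\<bar> \<le> e/4"
    using assms[of "e/4"] by auto
  have "\<forall>\<^sub>F i in F. dist (g i) m < e/4"
    using g \<open>0 < e\<close> by (auto dest!: tendstoD[of _ _ _ "e/4"])
  then show "\<forall>\<^sub>F i in F. dist (f i) l < e"
  proof eventually_elim
    case (elim i)
    with fg[of i] lm \<open>0 < e\<close> show ?case unfolding dist_real_def by linarith
  qed
qed

text \<open>The phase \<open>c\<close> is quantified so that the cosine covers the sine as well; at \<open>c = -\<pi>/2\<close> it is one.\<close>

definition oscillation_vanishes :: "'a measure \<Rightarrow> ('a \<Rightarrow> real) \<Rightarrow> ('a \<Rightarrow> real) \<Rightarrow> bool"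
  where "oscillation_vanishes M W f \<longleftrightarrow>
    (\<forall>c. ((\<lambda>t. \<integral>x. f x * cos (t * W x + c) \<partial>M) \<longlongrightarrow> 0) at_top)"

lemma integrable_mult_cos:
  fixes f :: "'a \<Rightarrow> real"
  assumes "integrable M f" and [measurable]: "W \<in> borel_measurable M"
  shows "integrable M (\<lambda>x. f x * cos (W x))"
proof (rule Bochner_Integration.integrable_bound[OF assms(1)])
  show "AE x in M. norm (f x * cos (W x)) \<le> norm (f x)"
    by (auto simp: abs_mult intro!: AE_I2 mult_left_le)
qed (use assms(1) in measurable)

lemma oscillation_vanishes_add:
  assumes [measurable]: "W \<in> borel_measurable M" and "integrable M f" "integrable M g"
    and "oscillation_vanishes M W f" "oscillation_vanishes M W g"
  shows "oscillation_vanishes M W (\<lambda>x. f x + g x)"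
  unfolding oscillation_vanishes_def
proof
  fix c
  have "(\<integral>x. (f x + g x) * cos (t * W x + c) \<partial>M)
      = (\<integral>x. f x * cos (t * W x + c) \<partial>M) + (\<integral>x. g x * cos (t * W x + c) \<partial>M)" for t
    using assms(2,3) by (simp add: distrib_right Bochner_Integration.integral_add integrable_mult_cos)
  then show "((\<lambda>t. \<integral>x. (f x + g x) * cos (t * W x + c) \<partial>M) \<longlongrightarrow> 0) at_top"
    using tendsto_add[of "\<lambda>t. \<integral>x. f x * cos (t * W x + c) \<partial>M" 0 at_top
        "\<lambda>t. \<integral>x. g x * cos (t * W x + c) \<partial>M" 0] assms(4,5)
    by (simp add: oscillation_vanishes_def)
qed

lemma oscillation_vanishes_mult:
  assumes "oscillation_vanishes M W f"
  shows "oscillation_vanishes M W (\<lambda>x. a * f x)"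
  using assms tendsto_mult_left[of _ 0 at_top a]
  unfolding oscillation_vanishes_def by (fastforce simp: mult.assoc)

text \<open>Replacing \<open>f\<close> by \<open>s i\<close> changes the integral by at most the \<open>L\<^sup>1\<close> distance of the two, uniformly in
  the frequency \<open>t\<close>.\<close>

lemma oscillation_vanishes_dominated_limit:
  assumes [measurable]: "W \<in> borel_measurable M" and s: "\<And>i. s i \<in> borel_measurable M"
    and w: "integrable M w" and bound: "\<And>i x. x \<in> space M \<Longrightarrow> \<bar>s i x\<bar> \<le> w x"
    and lim: "\<And>x. x \<in> space M \<Longrightarrow> (\<lambda>i. s i x) \<longlonglongrightarrow> f x"
    and van: "\<And>i. oscillation_vanishes M W (s i)"
  shows "oscillation_vanishes M W f"
  unfolding oscillation_vanishes_def
proof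
  fix c
  note [measurable] = s borel_measurable_integrable[OF w]
  have [measurable]: "f \<in> borel_measurable M"
    by (rule borel_measurable_LIMSEQ_metric[OF s lim])
  have si: "integrable M (s i)" for i
    by (rule Bochner_Integration.integrable_bound[OF w]) (auto intro!: AE_I2 order_trans[OF bound])
  have fb: "\<bar>f x\<bar> \<le> w x" if "x \<in> space M" for x
    by (rule LIMSEQ_le_const2[OF tendsto_rabs[OF lim[OF that]]]) (use bound[OF that] in auto)
  have fi: "integrable M f"
    by (rule Bochner_Integration.integrable_bound[OF w]) (auto intro!: AE_I2 order_trans[OF fb])
  have "(\<lambda>i. \<integral>x. \<bar>f x - s i x\<bar> \<partial>M) \<longlonglongrightarrow> (\<integral>x. 0 \<partial>M)"
  proof (rule integral_dominated_convergence[where w="\<lambda>x. 2 * w x"])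
    show "AE x in M. (\<lambda>i. \<bar>f x - s i x\<bar>) \<longlonglongrightarrow> 0"
    proof (rule AE_I2)
      fix x assume "x \<in> space M"
      have "(\<lambda>i. \<bar>f x - s i x\<bar>) \<longlonglongrightarrow> \<bar>f x - f x\<bar>"
        by (intro tendsto_intros lim) fact
      then show "(\<lambda>i. \<bar>f x - s i x\<bar>) \<longlonglongrightarrow> 0" by simp
    qed
    show "AE x in M. norm \<bar>f x - s i x\<bar> \<le> 2 * w x" for i
    proof (rule AE_I2)
      fix x assume "x \<in> space M"
      then show "norm \<bar>f x - s i x\<bar> \<le> 2 * w x" using bound[of x i] fb[of x] by simp
    qed
  qed (use w in auto)
  then have small: "(\<lambda>i. \<integral>x. \<bar>f x - s i x\<bar> \<partial>M) \<longlonglongrightarrow> 0" by simp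
  show "((\<lambda>t. \<integral>x. f x * cos (t * W x + c) \<partial>M) \<longlongrightarrow> 0) at_top"
  proof (rule tendsto_by_approximation)
    fix e :: real assume "0 < e"
    then obtain i where i: "(\<integral>x. \<bar>f x - s i x\<bar> \<partial>M) < e"
      using order_tendstoD(2)[OF small] by (auto simp: eventually_sequentially)
    have "\<bar>(\<integral>x. f x * cos (t * W x + c) \<partial>M) - (\<integral>x. s i x * cos (t * W x + c) \<partial>M)\<bar> \<le> e" for t
    proof -
      have "\<bar>(\<integral>x. f x * cos (t * W x + c) \<partial>M) - (\<integral>x. s i x * cos (t * W x + c) \<partial>M)\<bar>
          = \<bar>\<integral>x. (f x - s i x) * cos (t * W x + c) \<partial>M\<bar>"
        using fi si by (simp add: left_diff_distrib Bochner_Integration.integral_diff integrable_mult_cos)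
      also have "\<dots> \<le> (\<integral>x. \<bar>(f x - s i x) * cos (t * W x + c)\<bar> \<partial>M)" by (rule integral_abs_bound)
      also have "\<dots> \<le> (\<integral>x. \<bar>f x - s i x\<bar> \<partial>M)"
      proof (rule integral_mono)
        show "integrable M (\<lambda>x. \<bar>(f x - s i x) * cos (t * W x + c)\<bar>)"
          using fi si by (intro integrable_abs integrable_mult_cos) auto
      qed (use fi si in \<open>auto simp: abs_mult intro!: mult_left_le\<close>)
      finally show ?thesis using i by simp
    qed
    then show "\<exists>g m. (g \<longlongrightarrow> m) at_top \<and>
        (\<forall>t. \<bar>(\<integral>x. f x * cos (t * W x + c) \<partial>M) - g t\<bar> \<le> e) \<and> \<bar>0 - m\<bar> \<le> e"
      using van[of i] \<open>0 < e\<close> unfolding oscillation_vanishes_def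
      by (intro exI[of _ "\<lambda>t. \<integral>x. s i x * cos (t * W x + c) \<partial>M"] exI[of _ 0]) auto
  qed
qed

lemma oscillation_vanishes_interval:
  "oscillation_vanishes lborel (\<lambda>r. r) (indicator {a..b})"
  unfolding oscillation_vanishes_def
proof
  fix c
  show "((\<lambda>t. \<integral>x. indicator {a..b} x * cos (t * x + c) \<partial>lborel) \<longlongrightarrow> 0) at_top"
  proof (cases "a \<le> b")
    case True
    have eq: "(\<integral>x. indicator {a..b} x * cos (t * x + c) \<partial>lborel)
        = (sin (t * b + c) - sin (t * a + c)) / t" if "0 < t" for t
    proof -
      have "(\<integral>x. cos (t * x + c) * indicator {a..b} x \<partial>lborel) = sin (t * b + c) / t - sin (t * a + c) / t"
        by (rule integral_FTC_Icc_real[OF True])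
          (use that in \<open>auto intro!: derivative_eq_intros continuous_intros\<close>)
      then show ?thesis by (simp add: mult.commute diff_divide_distrib)
    qed
    have "\<forall>\<^sub>F t in at_top. norm (\<integral>x. indicator {a..b} x * cos (t * x + c) \<partial>lborel) \<le> 2 / t"
      using eventually_gt_at_top[of 0]
    proof eventually_elim
      case (elim t)
      have "\<bar>sin (t * b + c) - sin (t * a + c)\<bar> \<le> 2"
        using abs_sin_le_one[of "t * b + c"] abs_sin_le_one[of "t * a + c"] by linarith
      then show ?case using elim unfolding eq[OF elim] by (simp add: divide_right_mono)
    qed
    then show ?thesis
      by (rule Lim_null_comparison)
        (intro tendsto_divide_0[OF tendsto_const] filterlim_at_top_imp_at_infinity filterlim_ident)
  qed simp
qed

text \<open>Inside a bounded window the sets with this property form a Dynkin system: complements and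
  disjoint unions are handled by linearity and dominated convergence, with the window as
  dominating function. The window then grows to the whole line.\<close>

lemma oscillation_vanishes_Borel_set:
  assumes A: "A \<in> sets (borel :: real measure)" and fin: "emeasure lborel A < \<infinity>"
  shows "oscillation_vanishes lborel (\<lambda>r. r) (indicator A)"
proof -
  have bounded: "oscillation_vanishes lborel (\<lambda>r. r) (indicator (A \<inter> {-N..N}))" for N :: real
  proof -
    let ?w = "indicator {-N..N} :: real \<Rightarrow> real"
    have fin: "emeasure lborel {-N..N} < \<infinity>"
      using emeasure_compact_finite[of "{-N..N}"] by simp
    have intI: "integrable lborel (indicator (X \<inter> {-N..N}) :: real \<Rightarrow> real)"
      if [measurable]: "X \<in> sets borel" for X
    proof (rule integrable_real_indicator)
      show "emeasure lborel (X \<inter> {-N..N}) < \<infinity>"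
        by (rule le_less_trans[OF emeasure_mono fin]) auto
    qed auto
    have w: "integrable lborel ?w" by (rule integrable_real_indicator) (use fin in auto)
    have G: "Int_stable (range (\<lambda>(a, b). {a..b::real}))"
    proof (rule Int_stableI, safe)
      fix a b a' b' :: real
      show "{a..b} \<inter> {a'..b'} \<in> range (\<lambda>(a, b). {a..b})"
        by (auto intro!: image_eqI[of _ _ "(max a a', min b b')"])
    qed
    have "A \<in> sigma_sets UNIV (range (\<lambda>(a, b). {a..b::real}))"
      using A unfolding borel_eq_atLeastAtMost by simp
    from G subset_UNIV[of "range (\<lambda>(a, b). {a..b::real})", folded Pow_UNIV] this show ?thesis
    proof (induction rule: sigma_sets_induct_disjoint)
      case (basic I)
      then obtain a b where "I = {a..b}" by auto
      then have "I \<inter> {-N..N} = {max a (-N)..min b N}" by auto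
      then show ?case using oscillation_vanishes_interval by metis
    next
      case empty
      show ?case by (simp add: oscillation_vanishes_def)
    next
      case (compl B)
      have [measurable]: "B \<in> sets borel" using compl(1) unfolding borel_eq_atLeastAtMost by simp
      have eq: "indicator ((UNIV - B) \<inter> {-N..N}) = (\<lambda>x. ?w x + (-1) * indicator (B \<inter> {-N..N}) x)"
        by (rule ext) (auto split: split_indicator)
      show ?case
        unfolding eq
      proof (rule oscillation_vanishes_add[OF _ w])
        show "integrable lborel (\<lambda>x. (-1) * indicator (B \<inter> {-N..N}) x :: real)"
          by (rule integrable_mult_right[OF intI]) measurable
      qed (simp, (rule oscillation_vanishes_interval oscillation_vanishes_mult[OF compl(2)])+)
    next
      case (union B)
      have [measurable]: "B i \<in> sets borel" for i
        using union(2) unfolding borel_eq_atLeastAtMost by auto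
      let ?s = "\<lambda>n x. \<Sum>i<n. indicator (B i \<inter> {-N..N}) x :: real"
      have disj: "disjoint_family_on (\<lambda>i. B i \<inter> {-N..N}) J" for J
        using union(1) unfolding disjoint_family_on_def by blast
      have s: "?s n x = indicator (\<Union>i<n. B i \<inter> {-N..N}) x" for n x
        by (rule indicator_UN_disjoint[symmetric, OF _ disj]) simp
      have ind: "oscillation_vanishes lborel (\<lambda>r. r) (?s n)" for n
      proof (induction n)
        case (Suc n)
        have "integrable lborel (?s n)" "integrable lborel (indicator (B n \<inter> {-N..N}) :: real \<Rightarrow> real)"
          by (auto intro!: Bochner_Integration.integrable_sum intI)
        from oscillation_vanishes_add[OF _ this Suc union(3)] show ?case by simp
      qed (simp add: oscillation_vanishes_def)
      show ?case
      proof (rule oscillation_vanishes_dominated_limit[OF _ _ w _ _ ind])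
        show "\<bar>?s n x\<bar> \<le> ?w x" for n x
          unfolding s by (simp add: indicator_def)
        have "(\<Union>i. B i) \<inter> {-N..N} = (\<Union>i. B i \<inter> {-N..N})" by blast
        then show "(\<lambda>n. ?s n x) \<longlonglongrightarrow> indicator ((\<Union>i. B i) \<inter> {-N..N}) x" for x
          unfolding s using LIMSEQ_indicator_UN[of "\<lambda>i. B i \<inter> {-N..N}" x] by simp
      qed auto
    qed
  qed
  show ?thesis
  proof (rule oscillation_vanishes_dominated_limit[of _ _ "\<lambda>n. indicator (A \<inter> {-real n..real n})" "indicator A"])
    show "(\<lambda>n. indicator (A \<inter> {- real n..real n}) x :: real) \<longlonglongrightarrow> indicator A x" for x
    proof (rule tendsto_eventually)
      show "\<forall>\<^sub>F n in sequentially. indicator (A \<inter> {- real n..real n}) x = (indicator A x :: real)"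
        using eventually_ge_at_top[of "nat \<lceil>\<bar>x\<bar>\<rceil>"]
        by eventually_elim (auto split: split_indicator simp: le_nat_iff nat_le_iff ceiling_le_iff abs_le_iff)
    qed
  qed (use A fin bounded in \<open>auto split: split_indicator\<close>)
qed

theorem Riemann_Lebesgue_lborel:
  assumes "integrable lborel (f :: real \<Rightarrow> real)"
  shows "oscillation_vanishes lborel (\<lambda>r. r) f"
  using assms
proof induction
  case (base A c)
  then show ?case
    using oscillation_vanishes_mult[OF oscillation_vanishes_Borel_set[of A], of c]
    by (simp add: mult.commute)
next
  case (add f g)
  then show ?case by (intro oscillation_vanishes_add) auto
next
  case (lim f s)
  show ?case
    by (rule oscillation_vanishes_dominated_limit[where s=s and w="\<lambda>x. 2 * \<bar>f x\<bar>"])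
      (use lim in auto)
qed

text \<open>The law of \<open>W\<close> under the measure with density \<open>k\<close> has itself a density on the real line, by
  Radon--Nikodym, so the classical lemma applies to that density. Absolute continuity is
  demanded only where \<open>k\<close> does not vanish: \<open>W\<close> will be a frequency that is meaningful over a
  single chart domain, on which \<open>k\<close> is supported.\<close>

theorem Riemann_Lebesgue_absolutely_continuous:
  assumes k: "integrable M k" and W [measurable]: "W \<in> borel_measurable M"
    and ac: "\<And>N. N \<in> null_sets lborel \<Longrightarrow> AE x in M. W x \<in> N \<longrightarrow> k x = 0"
  shows "oscillation_vanishes M W k"
proof -
  have pos: "oscillation_vanishes M W k"
    if k: "integrable M k" and nonneg: "\<And>x. 0 \<le> k x"
      and ac: "\<And>N. N \<in> null_sets lborel \<Longrightarrow> AE x in M. W x \<in> N \<longrightarrow> k x = 0" for k :: "'a \<Rightarrow> real"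
  proof -
    note [measurable] = borel_measurable_integrable[OF k]
    let ?D = "density M (\<lambda>x. ennreal (k x))"
    define \<rho> where "\<rho> = distr ?D lborel W"
    have fin: "finite_measure \<rho>"
    proof
      have "emeasure \<rho> (space \<rho>) = (\<integral>\<^sup>+x. ennreal (k x) \<partial>M)"
        by (simp add: \<rho>_def emeasure_distr emeasure_density cong: nn_integral_cong)
      also have "\<dots> = ennreal (\<integral>x. k x \<partial>M)"
        by (rule nn_integral_eq_integral[OF k]) (simp add: nonneg)
      finally show "emeasure \<rho> (space \<rho>) \<noteq> \<infinity>" by simp
    qed
    have "absolutely_continuous lborel \<rho>"
      unfolding absolutely_continuous_def
    proof
      fix N :: "real set" assume N: "N \<in> null_sets lborel"
      then have [measurable]: "N \<in> sets borel" by auto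
      have "emeasure \<rho> N = (\<integral>\<^sup>+x. ennreal (k x) * indicator (W -` N \<inter> space M) x \<partial>M)"
        by (simp add: \<rho>_def emeasure_distr emeasure_density)
      also have "\<dots> = (\<integral>\<^sup>+x. 0 \<partial>M)"
        by (rule nn_integral_cong_AE) (use ac[OF N] in \<open>auto split: split_indicator\<close>)
      finally show "N \<in> null_sets \<rho>" by (auto simp: \<rho>_def)
    qed
    then obtain D where D [measurable]: "D \<in> borel_measurable lborel"
      and RN: "AE x in lborel. RN_deriv lborel \<rho> x = ennreal (D x)" and D0: "\<And>x. 0 \<le> D x"
      using sigma_finite_measure.real_RN_deriv[OF sigma_finite_lborel fin] by (metis \<rho>_def sets_distr)
    have "density lborel (\<lambda>x. ennreal (D x)) = density lborel (RN_deriv lborel \<rho>)"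
      by (rule density_cong) (use RN in auto)
    also have "\<dots> = \<rho>"
      by (rule sigma_finite_measure.density_RN_deriv[OF sigma_finite_lborel]) (auto simp: \<rho>_def \<open>absolutely_continuous lborel \<rho>\<close>[unfolded \<rho>_def])
    finally have dens: "density lborel (\<lambda>x. ennreal (D x)) = \<rho>" .
    have "integrable lborel D"
    proof (rule integrableI_nonneg)
      have "(\<integral>\<^sup>+x. ennreal (D x) \<partial>lborel) = emeasure \<rho> (space \<rho>)"
        unfolding dens[symmetric] by (simp add: emeasure_density cong: nn_integral_cong)
      then show "(\<integral>\<^sup>+x. ennreal (D x) \<partial>lborel) < \<infinity>"
        using finite_measure.emeasure_finite[OF fin] by (simp add: less_top)
    qed (use D0 in auto)
    from Riemann_Lebesgue_lborel[OF this] have RL: "oscillation_vanishes lborel (\<lambda>r. r) D" .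
    have "(\<integral>x. k x * cos (t * W x + c) \<partial>M) = (\<integral>r. D r * cos (t * r + c) \<partial>lborel)" for t c
    proof -
      have "(\<integral>x. k x * cos (t * W x + c) \<partial>M) = (\<integral>x. cos (t * W x + c) \<partial>?D)"
        by (subst integral_density) (use nonneg in auto)
      also have "\<dots> = (\<integral>r. cos (t * r + c) \<partial>\<rho>)"
        unfolding \<rho>_def by (subst integral_distr) auto
      also have "\<dots> = (\<integral>r. D r * cos (t * r + c) \<partial>lborel)"
        unfolding dens[symmetric] by (subst integral_density) (use D0 in auto)
      finally show ?thesis .
    qed
    with RL show ?thesis unfolding oscillation_vanishes_def by simp
  qed
  have "oscillation_vanishes M W (\<lambda>x. max 0 (k x))" "oscillation_vanishes M W (\<lambda>x. max 0 (- k x))"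
    using k ac by (auto intro!: pos elim!: AE_mp[OF ac])
  then have "oscillation_vanishes M W (\<lambda>x. max 0 (k x) + (-1) * max 0 (- k x))"
    using k by (intro oscillation_vanishes_add oscillation_vanishes_mult) auto
  moreover have "(\<lambda>x. max 0 (k x) + (-1) * max 0 (- k x)) = k" by auto
  ultimately show ?thesis by simp
qed

section \<open>Weak convergence along a measure preserving flow\<close>

lemma L2_mult_integrable:
  assumes "f \<in> L2 M" "h \<in> L2 M"
  shows "integrable M (\<lambda>x. f x * h x)"
proof (rule Bochner_Integration.integrable_bound)
  show "integrable M (\<lambda>x. (f x)\<^sup>2 + (h x)\<^sup>2)" using assms by (auto simp: L2_def)
  have "\<bar>a * b\<bar> \<le> a\<^sup>2 + b\<^sup>2" for a b :: real
    using sum_squares_bound[of "\<bar>a\<bar>" "\<bar>b\<bar>"] mult_nonneg_nonneg[of "\<bar>a\<bar>" "\<bar>b\<bar>"]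
    unfolding abs_mult power2_abs mult.assoc by linarith
  then show "AE x in M. norm (f x * h x) \<le> norm ((f x)\<^sup>2 + (h x)\<^sup>2)"
    by (auto intro!: AE_I2)
qed (use assms in \<open>auto simp: L2_def\<close>)

lemma L2_dominated:
  assumes "f \<in> borel_measurable M" "w \<in> L2 M" "\<And>x. x \<in> space M \<Longrightarrow> \<bar>f x\<bar> \<le> \<bar>w x\<bar>"
  shows "f \<in> L2 M"
  unfolding L2_def
proof safe
  show "integrable M (\<lambda>x. (f x)\<^sup>2)"
  proof (rule Bochner_Integration.integrable_bound)
    show "integrable M (\<lambda>x. (w x)\<^sup>2)" using assms by (simp add: L2_def)
    show "AE x in M. norm ((f x)\<^sup>2) \<le> norm ((w x)\<^sup>2)"
      using assms(3) by (auto intro!: AE_I2 simp: abs_le_square_iff)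
  qed (use assms in auto)
qed fact

lemma L2_add:
  assumes "f \<in> L2 M" "h \<in> L2 M"
  shows "(\<lambda>x. f x + h x) \<in> L2 M"
proof -
  have "(\<lambda>x. (f x + h x)\<^sup>2) = (\<lambda>x. (f x)\<^sup>2 + (h x)\<^sup>2 + 2 * (f x * h x))"
    by (simp add: power2_sum fun_eq_iff)
  moreover have "integrable M (\<lambda>x. (f x)\<^sup>2 + (h x)\<^sup>2 + 2 * (f x * h x))"
    using assms L2_mult_integrable[OF assms] by (simp add: L2_def)
  moreover have "(\<lambda>x. f x + h x) \<in> borel_measurable M"
    using assms by (simp add: L2_def borel_measurable_add)
  ultimately show ?thesis by (simp add: L2_def)
qed

lemma L2_scale: "f \<in> L2 M \<Longrightarrow> (\<lambda>x. c * f x) \<in> L2 M"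
  by (auto simp: L2_def power_mult_distrib)

lemma L2_diff:
  assumes "f \<in> L2 M" "h \<in> L2 M"
  shows "(\<lambda>x. f x - h x) \<in> L2 M"
  using L2_add[OF assms(1) L2_scale[OF assms(2), of "-1"]] by simp

lemma (in finite_measure) L2_bounded:
  assumes "f \<in> borel_measurable M" "\<And>x. x \<in> space M \<Longrightarrow> \<bar>f x\<bar> \<le> c"
  shows "f \<in> L2 M"
  by (rule L2_dominated[of _ _ "\<lambda>_. c"]) (use assms in \<open>fastforce simp: L2_def\<close>)+

lemma (in finite_measure) L2_integrable:
  assumes "f \<in> L2 M"
  shows "integrable M f"
  using L2_mult_integrable[OF assms L2_bounded[of "\<lambda>_. 1" 1]] by simp

text \<open>The Cauchy--Schwarz inequality in the form of a weighted arithmetic--geometric mean inequality,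
  with a free weight \<open>\<delta>\<close>.\<close>

lemma L2_pairing_bound:
  assumes u: "u \<in> L2 M" and h: "h \<in> L2 M" and "0 < \<delta>"
  shows "\<bar>\<integral>x. u x * h x \<partial>M\<bar> \<le> ((\<integral>x. (u x)\<^sup>2 \<partial>M) / \<delta> + \<delta> * (\<integral>x. (h x)\<^sup>2 \<partial>M)) / 2"
proof -
  have pw: "\<bar>a * b\<bar> \<le> (a\<^sup>2 / \<delta> + \<delta> * b\<^sup>2) / 2" for a b
  proof -
    \<comment> \<open>expanding this square is the inequality to be shown\<close>
    have "0 \<le> (\<bar>a\<bar> - \<delta> * \<bar>b\<bar>)\<^sup>2 / \<delta>" using \<open>0 < \<delta>\<close> by simp
    also have "\<dots> = a\<^sup>2 / \<delta> + \<delta> * b\<^sup>2 - 2 * \<bar>a * b\<bar>"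
      using \<open>0 < \<delta>\<close> by (simp add: power2_diff power_mult_distrib field_simps abs_mult power2_eq_square)
    finally show ?thesis by simp
  qed
  have "\<bar>\<integral>x. u x * h x \<partial>M\<bar> \<le> (\<integral>x. \<bar>u x * h x\<bar> \<partial>M)" by (rule integral_abs_bound)
  also have "\<dots> \<le> (\<integral>x. ((u x)\<^sup>2 / \<delta> + \<delta> * (h x)\<^sup>2) / 2 \<partial>M)"
    using L2_mult_integrable[OF u h] u h by (intro integral_mono pw) (auto simp: L2_def)
  also have "\<dots> = ((\<integral>x. (u x)\<^sup>2 \<partial>M) / \<delta> + \<delta> * (\<integral>x. (h x)\<^sup>2 \<partial>M)) / 2"
    using u h by (simp add: L2_def)
  finally show ?thesis .
qed

lemma L2_dominated_convergence:
  assumes w: "w \<in> L2 M" and s: "\<And>i. s i \<in> borel_measurable M"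
    and bound: "\<And>i x. x \<in> space M \<Longrightarrow> \<bar>s i x\<bar> \<le> w x"
    and lim: "\<And>x. x \<in> space M \<Longrightarrow> (\<lambda>i. s i x) \<longlonglongrightarrow> f x"
  shows "f \<in> L2 M" and "(\<lambda>i. \<integral>x. (f x - s i x)\<^sup>2 \<partial>M) \<longlonglongrightarrow> 0"
proof -
  note [measurable] = s
  have [measurable]: "f \<in> borel_measurable M" "w \<in> borel_measurable M"
    using borel_measurable_LIMSEQ_metric[OF s lim] w by (auto simp: L2_def)
  have fb: "\<bar>f x\<bar> \<le> w x" if "x \<in> space M" for x
    by (rule LIMSEQ_le_const2[OF tendsto_rabs[OF lim[OF that]]]) (use bound[OF that] in auto)
  then show "f \<in> L2 M"
    by (intro L2_dominated[OF _ w]) (auto intro: order_trans[OF _ abs_ge_self])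
  have "(\<lambda>i. \<integral>x. (f x - s i x)\<^sup>2 \<partial>M) \<longlonglongrightarrow> (\<integral>x. 0 \<partial>M)"
  proof (rule integral_dominated_convergence[where w="\<lambda>x. 4 * (w x)\<^sup>2"])
    show "AE x in M. (\<lambda>i. (f x - s i x)\<^sup>2) \<longlonglongrightarrow> 0"
    proof (rule AE_I2)
      fix x assume "x \<in> space M"
      have "(\<lambda>i. (f x - s i x)\<^sup>2) \<longlonglongrightarrow> (f x - f x)\<^sup>2"
        by (intro tendsto_intros lim) fact
      then show "(\<lambda>i. (f x - s i x)\<^sup>2) \<longlonglongrightarrow> 0" by simp
    qed
    show "AE x in M. norm ((f x - s i x)\<^sup>2) \<le> 4 * (w x)\<^sup>2" for i
    proof (rule AE_I2)
      fix x assume "x \<in> space M"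
      then have "\<bar>f x - s i x\<bar> \<le> \<bar>2 * w x\<bar>" using bound[of x i] fb[of x] by simp
      then show "norm ((f x - s i x)\<^sup>2) \<le> 4 * (w x)\<^sup>2"
        by (simp add: abs_le_square_iff power_mult_distrib)
    qed
  qed (use w in \<open>auto simp: L2_def\<close>)
  then show "(\<lambda>i. \<integral>x. (f x - s i x)\<^sup>2 \<partial>M) \<longlonglongrightarrow> 0" by simp
qed

locale measure_preserving_flow = prob_space M for M :: "'a measure" +
  fixes g :: "real \<Rightarrow> 'a \<Rightarrow> 'a"
  assumes flow: "is_flow g" and preserves: "preserves_measure M g"
begin

abbreviation "invariants \<equiv> invariant_algebra M g"

lemma flow_measurable [measurable]: "g t \<in> measurable M M"
  using preserves by (simp add: preserves_measure_def)

lemma distr_flow: "distr M M (g t) = M"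
  using preserves by (simp add: preserves_measure_def)

lemma flow_in_space: "z \<in> space M \<Longrightarrow> g t z \<in> space M"
  using measurable_space[OF flow_measurable] .

text \<open>Stated with \<open>AE\<close>, the condition \<open>g\<^sub>t\<^sup>-\<^sup>1 A = A\<close> up to null sets visibly passes to complements and
  countable unions, so the generating family of the invariant \<open>\<sigma>\<close>-algebra already is one.\<close>

lemma sets_invariant_algebra:
  "sets invariants = {A \<in> sets M. \<forall>t. AE z in M. g t z \<in> A \<longleftrightarrow> z \<in> A}"
proof -
  let ?X = "{A \<in> sets M. \<forall>t. AE z in M. g t z \<in> A \<longleftrightarrow> z \<in> A}"
  have "{A \<in> sets M. \<forall>t. sym_diff (g t -` A \<inter> space M) A \<in> null_sets M} = ?X"
  proof (intro Collect_cong conj_cong refl iff_allI)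
    fix A t assume A [measurable]: "A \<in> sets M"
    have eq: "sym_diff (g t -` A \<inter> space M) A = {z \<in> space M. \<not> (g t z \<in> A \<longleftrightarrow> z \<in> A)}"
      using sets.sets_into_space[OF A] by auto
    show "sym_diff (g t -` A \<inter> space M) A \<in> null_sets M \<longleftrightarrow> (AE z in M. g t z \<in> A \<longleftrightarrow> z \<in> A)"
      unfolding eq by (rule AE_iff_null[symmetric]) measurable
  qed
  then have "sets invariants = sigma_sets (space M) ?X"
    unfolding invariant_algebra_def
    by (simp only:) (rule sets_measure_of, use sets.sets_into_space in blast)
  also have "\<dots> = ?X"
  proof (rule sigma_algebra.sigma_sets_eq, unfold sigma_algebra_iff2, intro conjI ballI allI impI)
    show "?X \<subseteq> Pow (space M)" using sets.sets_into_space by auto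
    show "space M - A \<in> ?X" if "A \<in> ?X" for A
    proof -
      have "AE z in M. g t z \<in> space M - A \<longleftrightarrow> z \<in> space M - A" for t
      proof -
        have "AE z in M. g t z \<in> A \<longleftrightarrow> z \<in> A" using that by blast
        with AE_space show ?thesis by eventually_elim (use flow_in_space in blast)
      qed
      moreover have "space M - A \<in> sets M" using that by blast
      ultimately show ?thesis by blast
    qed
    show "(\<Union>i. A i) \<in> ?X" if A: "range A \<subseteq> ?X" for A :: "nat \<Rightarrow> 'a set"
    proof -
      have "AE z in M. g t z \<in> (\<Union>i. A i) \<longleftrightarrow> z \<in> (\<Union>i. A i)" for t
      proof -
        have "AE z in M. \<forall>i. g t z \<in> A i \<longleftrightarrow> z \<in> A i"
          unfolding AE_all_countable using A by blast
        then show ?thesis by eventually_elim simp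
      qed
      moreover have "(\<Union>i. A i) \<in> sets M" using A by (intro sets.countable_UN) blast
      ultimately show ?thesis by blast
    qed
  qed auto
  finally show ?thesis .
qed

lemma subalgebra_invariants: "subalgebra M invariants"
proof -
  have "space invariants = space M" unfolding invariant_algebra_def by (rule space_measure_of_conv)
  then show ?thesis unfolding subalgebra_def sets_invariant_algebra by blast
qed

sublocale inv: finite_measure_subalgebra M invariants
  by unfold_locales (rule subalgebra_invariants)

abbreviation "cond \<equiv> real_cond_exp M invariants"

lemma integral_flow:
  fixes f :: "'a \<Rightarrow> real"
  assumes "f \<in> borel_measurable M"
  shows "(\<integral>z. f (g t z) \<partial>M) = (\<integral>z. f z \<partial>M)"
  using integral_distr[OF flow_measurable assms, of t] by (simp add: distr_flow)

lemma integrable_flow: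
  fixes f :: "'a \<Rightarrow> real"
  assumes "integrable M f"
  shows "integrable M (\<lambda>z. f (g t z))"
  using integrable_distr[OF flow_measurable, of t f] assms by (simp add: distr_flow)

lemma L2_flow: "f \<in> L2 M \<Longrightarrow> (\<lambda>z. f (g t z)) \<in> L2 M"
  using integrable_flow[of "\<lambda>z. (f z)\<^sup>2" t] by (auto simp: L2_def)

text \<open>Jensen's inequality for the square makes conditional expectation a contraction of \<open>L\<^sup>2\<close>.\<close>

lemma L2_cond:
  assumes f: "f \<in> L2 M"
  shows "cond f \<in> L2 M" and "(\<integral>z. (cond f z)\<^sup>2 \<partial>M) \<le> (\<integral>z. (f z)\<^sup>2 \<partial>M)"
proof -
  note [measurable] = borel_measurable_cond_exp2
  have int: "integrable M f" "integrable M (\<lambda>z. (f z)\<^sup>2)"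
    using L2_integrable[OF f] f by (simp_all add: L2_def)
  have J: "AE z in M. (cond f z)\<^sup>2 \<le> cond (\<lambda>z. (f z)\<^sup>2) z"
    using inv.real_cond_exp_jensens_inequality(2)[OF int(1), where I = UNIV and q = "\<lambda>r. r\<^sup>2"] int(2)
      convex_power2 by simp
  have int': "integrable M (cond (\<lambda>z. (f z)\<^sup>2))" by (rule inv.real_cond_exp_int(1)) fact
  have sq: "integrable M (\<lambda>z. (cond f z)\<^sup>2)"
  proof (rule Bochner_Integration.integrable_bound[OF int'])
    show "AE z in M. norm ((cond f z)\<^sup>2) \<le> norm (cond (\<lambda>z. (f z)\<^sup>2) z)"
      using J by eventually_elim simp
  qed measurable
  then show "cond f \<in> L2 M" by (simp add: L2_def borel_measurable_cond_exp2)
  have "(\<integral>z. (cond f z)\<^sup>2 \<partial>M) \<le> (\<integral>z. cond (\<lambda>z. (f z)\<^sup>2) z \<partial>M)"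
    by (rule integral_mono_AE[OF sq int' J])
  also have "\<dots> = (\<integral>z. (f z)\<^sup>2 \<partial>M)" by (rule inv.real_cond_exp_int(2)) fact
  finally show "(\<integral>z. (cond f z)\<^sup>2 \<partial>M) \<le> (\<integral>z. (f z)\<^sup>2 \<partial>M)" .
qed

text \<open>The functions to which the conclusion of Keplerian shear applies.\<close>

definition relaxes :: "('a \<Rightarrow> real) \<Rightarrow> bool"
  where "relaxes f \<longleftrightarrow> f \<in> L2 M \<and>
    (\<forall>h\<in>L2 M. ((\<lambda>t. \<integral>z. f (g t z) * h z \<partial>M) \<longlongrightarrow> (\<integral>z. cond f z * h z \<partial>M)) at_top)"

text \<open>A weak limit \<open>F\<close> that is measurable with respect to the invariant sets must be the conditional
  expectation: testing against the indicator of an invariant set \<open>A\<close> gives a function of \<open>t\<close> that is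
  constantly \<open>\<integral>\<^sub>A f\<close>, by invariance of \<open>A\<close> and of the measure, hence \<open>\<integral>\<^sub>A F = \<integral>\<^sub>A f\<close>.\<close>

lemma relaxesI:
  assumes f: "f \<in> L2 M" and F: "F \<in> L2 M" "F \<in> borel_measurable invariants"
    and lim: "\<And>h. h \<in> L2 M \<Longrightarrow> ((\<lambda>t. \<integral>z. f (g t z) * h z \<partial>M) \<longlongrightarrow> (\<integral>z. F z * h z \<partial>M)) at_top"
  shows "relaxes f"
proof -
  note [measurable] = borel_measurable_cond_exp2
  have [measurable]: "f \<in> borel_measurable M" "F \<in> borel_measurable M"
    using f F by (auto simp: L2_def)
  have "AE z in M. cond f z = F z"
  proof (rule inv.real_cond_exp_charact)
    fix A assume "A \<in> sets invariants"
    then have A [measurable]: "A \<in> sets M" and inv: "\<And>t. AE z in M. g t z \<in> A \<longleftrightarrow> z \<in> A"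
      by (auto simp: sets_invariant_algebra)
    have "(\<integral>z. f (g t z) * indicator A z \<partial>M) = (\<integral>z. f z * indicator A z \<partial>M)" for t
    proof -
      have "(\<integral>z. f (g t z) * indicator A z \<partial>M) = (\<integral>z. f (g t z) * indicator A (g t z) \<partial>M)"
        by (rule integral_cong_AE) (use inv[of t] in \<open>auto split: split_indicator\<close>)
      also have "\<dots> = (\<integral>z. f z * indicator A z \<partial>M)"
        by (rule integral_flow[of "\<lambda>z. f z * indicator A z"]) measurable
      finally show ?thesis .
    qed
    moreover have "indicator A \<in> L2 M" by (rule L2_bounded[of _ 1]) (auto split: split_indicator)
    ultimately have "((\<lambda>t::real. \<integral>z. f z * indicator A z \<partial>M) \<longlongrightarrow> (\<integral>z. F z * indicator A z \<partial>M)) at_top"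
      using lim[of "indicator A"] by simp
    then have "(\<integral>z. f z * indicator A z \<partial>M) = (\<integral>z. F z * indicator A z \<partial>M)"
      by (simp add: tendsto_const_iff)
    then show "(\<integral>z\<in>A. f z \<partial>M) = (\<integral>z\<in>A. F z \<partial>M)"
      by (simp add: set_lebesgue_integral_def mult.commute)
  qed (use L2_integrable[OF f] L2_integrable[OF F(1)] F(2) in simp_all)
  then have "(\<integral>z. cond f z * h z \<partial>M) = (\<integral>z. F z * h z \<partial>M)" if "h \<in> L2 M" for h
    using that by (intro integral_cong_AE) (auto simp: L2_def)
  with f lim show ?thesis by (simp add: relaxes_def)
qed

lemma relaxes_add:
  assumes f: "relaxes f" and k: "relaxes k"
  shows "relaxes (\<lambda>z. f z + k z)"
  unfolding relaxes_def
proof (intro conjI ballI)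
  note [measurable] = borel_measurable_cond_exp2
  have L: "f \<in> L2 M" "k \<in> L2 M" using f k by (auto simp: relaxes_def)
  show "(\<lambda>z. f z + k z) \<in> L2 M" using L by (rule L2_add)
  fix h assume h: "h \<in> L2 M"
  have "(\<integral>z. cond (\<lambda>z. f z + k z) z * h z \<partial>M) = (\<integral>z. cond f z * h z + cond k z * h z \<partial>M)"
    by (rule integral_cong_AE)
      (use h inv.real_cond_exp_add[OF L2_integrable[OF L(1)] L2_integrable[OF L(2)]]
        in \<open>auto simp: L2_def distrib_right\<close>)
  also have "\<dots> = (\<integral>z. cond f z * h z \<partial>M) + (\<integral>z. cond k z * h z \<partial>M)"
    using L h by (intro Bochner_Integration.integral_add L2_mult_integrable L2_cond)
  finally have 1: "(\<integral>z. cond (\<lambda>z. f z + k z) z * h z \<partial>M)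
    = (\<integral>z. cond f z * h z \<partial>M) + (\<integral>z. cond k z * h z \<partial>M)" .
  have 2: "(\<integral>z. (f (g t z) + k (g t z)) * h z \<partial>M)
    = (\<integral>z. f (g t z) * h z \<partial>M) + (\<integral>z. k (g t z) * h z \<partial>M)" for t
    unfolding distrib_right
    using L h by (intro Bochner_Integration.integral_add L2_mult_integrable L2_flow)
  show "((\<lambda>t. \<integral>z. (f (g t z) + k (g t z)) * h z \<partial>M) \<longlongrightarrow> (\<integral>z. cond (\<lambda>z. f z + k z) z * h z \<partial>M)) at_top"
    unfolding 1 2 using f k h by (intro tendsto_add) (auto simp: relaxes_def)
qed

lemma relaxes_scale:
  assumes f: "relaxes f"
  shows "relaxes (\<lambda>z. c * f z)"
  unfolding relaxes_def
proof (intro conjI ballI)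
  note [measurable] = borel_measurable_cond_exp2
  have L: "f \<in> L2 M" using f by (auto simp: relaxes_def)
  show "(\<lambda>z. c * f z) \<in> L2 M" using L by (rule L2_scale)
  fix h assume h: "h \<in> L2 M"
  have "(\<integral>z. cond (\<lambda>z. c * f z) z * h z \<partial>M) = (\<integral>z. c * (cond f z * h z) \<partial>M)"
    by (rule integral_cong_AE)
      (use h inv.real_cond_exp_cmult[OF L2_integrable[OF L(1)], of c] in \<open>auto simp: L2_def\<close>)
  then show "((\<lambda>t. \<integral>z. (c * f (g t z)) * h z \<partial>M) \<longlongrightarrow> (\<integral>z. cond (\<lambda>z. c * f z) z * h z \<partial>M)) at_top"
    using f h by (auto simp: relaxes_def mult.assoc intro!: tendsto_mult_left)
qed

lemma relaxes_diff: "relaxes f \<Longrightarrow> relaxes k \<Longrightarrow> relaxes (\<lambda>z. f z - k z)"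
  using relaxes_add[OF _ relaxes_scale[of k "-1"], of f] by simp

lemma relaxes_zero: "relaxes (\<lambda>_. 0)"
  by (rule relaxesI[of _ "\<lambda>_. 0"]) (auto simp: L2_def)

lemma relaxes_sum:
  assumes "\<And>i. i \<in> J \<Longrightarrow> relaxes (f i)"
  shows "relaxes (\<lambda>z. \<Sum>i\<in>J. f i z)"
  using assms by (induction J rule: infinite_finite_induct) (auto intro: relaxes_zero relaxes_add)

text \<open>Composition with the flow and conditional expectation both do not increase \<open>L\<^sup>2\<close> norms.
  So, uniformly in time, the pairings with a fixed \<open>h\<close> for \<open>f\<close> and for an \<open>L\<^sup>2\<close>-close \<open>s i\<close> differ little, and
  so do the candidate limits.\<close>

lemma relaxes_dominated_limit:
  assumes w: "w \<in> L2 M" and s: "\<And>i. relaxes (s i)"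
    and bound: "\<And>i z. z \<in> space M \<Longrightarrow> \<bar>s i z\<bar> \<le> w z"
    and lim: "\<And>z. z \<in> space M \<Longrightarrow> (\<lambda>i. s i z) \<longlonglongrightarrow> f z"
  shows "relaxes f"
proof -
  note [measurable] = borel_measurable_cond_exp2
  have sL: "s i \<in> L2 M" for i using s by (simp add: relaxes_def)
  then have sm: "s i \<in> borel_measurable M" for i by (simp add: L2_def)
  have f: "f \<in> L2 M" and small: "(\<lambda>i. \<integral>z. (f z - s i z)\<^sup>2 \<partial>M) \<longlonglongrightarrow> 0"
    using L2_dominated_convergence[OF w sm bound lim] by auto
  have u: "(\<lambda>z. f z - s i z) \<in> L2 M" for i using f sL by (rule L2_diff)
  show ?thesis
    unfolding relaxes_def
  proof (intro conjI ballI f)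
    fix h assume h: "h \<in> L2 M"
    define H where "H = (\<integral>z. (h z)\<^sup>2 \<partial>M)"
    have "0 \<le> H" by (simp add: H_def)
    show "((\<lambda>t. \<integral>z. f (g t z) * h z \<partial>M) \<longlongrightarrow> (\<integral>z. cond f z * h z \<partial>M)) at_top"
    proof (rule tendsto_by_approximation)
      fix e :: real assume "0 < e"
      \<comment> \<open>balances the two terms of \<open>L2_pairing_bound\<close>: each becomes at most \<open>e\<close>\<close>
      define \<delta> where "\<delta> = e / (H + 1)"
      have "0 < \<delta>" using \<open>0 < e\<close> \<open>0 \<le> H\<close> by (simp add: \<delta>_def)
      have "\<delta> * H \<le> e" using \<open>0 < e\<close> \<open>0 \<le> H\<close> by (simp add: \<delta>_def field_simps)
      obtain i where i: "(\<integral>z. (f z - s i z)\<^sup>2 \<partial>M) < e * \<delta>"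
        using order_tendstoD(2)[OF small, of "e * \<delta>"] \<open>0 < e\<close> \<open>0 < \<delta>\<close>
        by (auto simp: eventually_sequentially)
      have pairing: "\<bar>\<integral>z. u z * h z \<partial>M\<bar> \<le> e"
        if "u \<in> L2 M" "(\<integral>z. (u z)\<^sup>2 \<partial>M) \<le> (\<integral>z. (f z - s i z)\<^sup>2 \<partial>M)" for u
      proof -
        have "\<bar>\<integral>z. u z * h z \<partial>M\<bar> \<le> ((\<integral>z. (u z)\<^sup>2 \<partial>M) / \<delta> + \<delta> * H) / 2"
          unfolding H_def by (rule L2_pairing_bound) fact+
        also have "\<dots> \<le> (e + e) / 2"
          using that(2) i \<open>0 < \<delta>\<close> \<open>\<delta> * H \<le> e\<close>
          by (intro divide_right_mono add_mono) (auto simp: pos_divide_le_eq)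
        finally show ?thesis by simp
      qed
      have "\<bar>(\<integral>z. f (g t z) * h z \<partial>M) - (\<integral>z. s i (g t z) * h z \<partial>M)\<bar> \<le> e" for t
      proof -
        have "(\<integral>z. f (g t z) * h z \<partial>M) - (\<integral>z. s i (g t z) * h z \<partial>M)
            = (\<integral>z. (f (g t z) - s i (g t z)) * h z \<partial>M)"
          unfolding left_diff_distrib
          using f sL h by (intro Bochner_Integration.integral_diff[symmetric] L2_mult_integrable L2_flow)
        also have "\<bar>\<dots>\<bar> \<le> e"
          using L2_flow[OF u[of i], of t] integral_flow[of "\<lambda>z. (f z - s i z)\<^sup>2" t] u[of i]
          by (intro pairing) (auto simp: L2_def)
        finally show ?thesis .
      qed
      moreover have "\<bar>(\<integral>z. cond f z * h z \<partial>M) - (\<integral>z. cond (s i) z * h z \<partial>M)\<bar> \<le> e"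
      proof -
        have "(\<integral>z. cond f z * h z \<partial>M) - (\<integral>z. cond (s i) z * h z \<partial>M)
            = (\<integral>z. cond f z * h z - cond (s i) z * h z \<partial>M)"
          using f sL h by (intro Bochner_Integration.integral_diff[symmetric] L2_mult_integrable L2_cond)
        also have "\<dots> = (\<integral>z. cond (\<lambda>z. f z - s i z) z * h z \<partial>M)"
          by (rule integral_cong_AE)
            (use h inv.real_cond_exp_diff[OF L2_integrable[OF f] L2_integrable[OF sL[of i]]]
              in \<open>auto simp: L2_def left_diff_distrib\<close>)
        also have "\<bar>\<dots>\<bar> \<le> e"
          by (intro pairing L2_cond u)
        finally show ?thesis .
      qed
      ultimately show "\<exists>k m. (k \<longlongrightarrow> m) at_top \<and>
          (\<forall>t. \<bar>(\<integral>z. f (g t z) * h z \<partial>M) - k t\<bar> \<le> e) \<and> \<bar>(\<integral>z. cond f z * h z \<partial>M) - m\<bar> \<le> e"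
        using s[of i] h unfolding relaxes_def by blast
    qed
  qed
qed

lemma relaxes_disjoint_UN:
  assumes A: "disjoint_family A" and rel: "\<And>i::nat. relaxes (indicator (A i))"
  shows "relaxes (indicator (\<Union>i. A i))"
proof -
  have s: "(\<Sum>i<n. indicator (A i) z) = (indicator (\<Union>i<n. A i) z :: real)" for n z
    by (rule indicator_UN_disjoint[symmetric]) (use A in \<open>auto simp: disjoint_family_on_def\<close>)
  show ?thesis
  proof (rule relaxes_dominated_limit[of "\<lambda>_. 1" "\<lambda>n z. \<Sum>i<n. indicator (A i) z"])
    show "(\<lambda>_. 1) \<in> L2 M" by (rule L2_bounded[of _ 1]) auto
    show "relaxes (\<lambda>z. \<Sum>i<n. indicator (A i) z)" for n by (intro relaxes_sum rel)
    show "\<bar>\<Sum>i<n. indicator (A i) z\<bar> \<le> (1::real)" for n z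
      unfolding s by (simp add: indicator_def)
    show "(\<lambda>n. \<Sum>i<n. indicator (A i) z) \<longlonglongrightarrow> (indicator (\<Union>i. A i) z :: real)" for z
      unfolding s by (rule LIMSEQ_indicator_UN)
  qed
qed

text \<open>Square integrable functions are dominated limits of simple functions.\<close>

theorem keplerian_shearI:
  assumes ind: "\<And>A. A \<in> sets M \<Longrightarrow> relaxes (indicator A)"
  shows "keplerian_shear M g"
proof -
  have rel: "relaxes f" if f: "f \<in> L2 M" for f
  proof -
    have "f \<in> borel_measurable M" using f by (simp add: L2_def)
    from borel_measurable_implies_sequence_metric[OF this, of 0] obtain s
      where s: "\<And>i. simple_function M (s i)" "\<And>z. z \<in> space M \<Longrightarrow> (\<lambda>i. s i z) \<longlonglongrightarrow> f z"
        and sb: "\<And>i z. z \<in> space M \<Longrightarrow> \<bar>s i z\<bar> \<le> 2 * \<bar>f z\<bar>"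
      unfolding dist_0_norm dist_commute[of _ "0::real"] real_norm_def by blast
    define s' where "s' i z = (\<Sum>y\<in>s i ` space M. y * indicator (s i -` {y} \<inter> space M) z)" for i z
    have s': "s' i z = s i z" if "z \<in> space M" for i z
    proof -
      have "s' i z = (\<Sum>y\<in>s i ` space M. if s i z = y then y else 0)"
        unfolding s'_def using that by (intro sum.cong) auto
      also have "\<dots> = s i z"
        using that simple_functionD(1)[OF s(1)[of i]] by (simp add: sum.delta')
      finally show ?thesis .
    qed
    have rel': "relaxes (s' i)" for i
      unfolding s'_def
      by (rule relaxes_sum, rule relaxes_scale, rule ind, rule simple_functionD, rule s(1))
    show ?thesis
    proof (rule relaxes_dominated_limit[OF _ rel'])
      show "(\<lambda>z. 2 * \<bar>f z\<bar>) \<in> L2 M"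
        using f unfolding L2_def by (auto simp: power_mult_distrib)
    qed (use s sb in \<open>simp_all add: s'\<close>)
  qed
  show ?thesis
    unfolding keplerian_shear_def weakly_tendsto_L2_def
    using prob_space_axioms flow preserves rel L2_flow L2_cond(1) by (simp add: relaxes_def comp_def)
qed

end

section \<open>The torus and its trigonometric polynomials\<close>

lemma torus_proj_eq_iff: "torus_proj x = torus_proj y \<longleftrightarrow> (\<exists>k. x = y + of_int_vec k)"
proof -
  have "torus_proj x = torus_proj y \<longleftrightarrow> x - y \<in> range of_int_vec"
    by (simp add: torus.abs_eq_iff torus_rel_def)
  also have "\<dots> \<longleftrightarrow> (\<exists>k. x = y + of_int_vec k)" by (auto simp: image_iff algebra_simps)
  finally show ?thesis .
qed

lemma torus_proj_rep [simp]: "torus_proj (rep_torus y) = y"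
  by (rule Quotient_abs_rep[OF Quotient_torus])

lemma torus_proj_add: "torus_proj (x + y) = torus_proj x + torus_proj y"
  by (simp add: plus_torus.abs_eq)

lemma torus_proj_add_int [simp]: "torus_proj (x + of_int_vec k) = torus_proj x"
  by (auto simp: torus_proj_eq_iff)

lemma continuous_torus_proj: "continuous_on A torus_proj"
  by (rule continuous_on_subset[of UNIV]) (auto simp: continuous_on_open_vimage open_torus_def)

lemma open_torus_proj_image:
  assumes "open B"
  shows "open (torus_proj ` B)"
proof -
  have "torus_proj -` torus_proj ` B = (\<Union>k. (+) (of_int_vec k) ` B)"
    by (auto simp: torus_proj_eq_iff image_iff add.commute) metis+
  then show ?thesis unfolding open_torus_def using assms by (auto intro: open_translation)
qed

lemma open_image_map_prod:
  assumes f: "\<And>S. open S \<Longrightarrow> S \<subseteq> A \<Longrightarrow> open (f ` S)" and h: "\<And>S. open S \<Longrightarrow> S \<subseteq> B \<Longrightarrow> open (h ` S)"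
    and V: "open V" "V \<subseteq> A \<times> B"
  shows "open (map_prod f h ` V)"
  unfolding open_prod_def
proof
  fix p assume "p \<in> map_prod f h ` V"
  then obtain x b where p: "p = (f x, h b)" and "(x, b) \<in> V" by auto
  then obtain S T where ST: "open S" "open T" "(x, b) \<in> S \<times> T" "S \<times> T \<subseteq> V"
    using open_prod_elim[OF V(1) \<open>(x, b) \<in> V\<close>] by blast
  then have "S \<subseteq> A" "T \<subseteq> B" using V(2) by blast+
  moreover have "f ` S \<times> h ` T \<subseteq> map_prod f h ` V"
    using image_mono[OF ST(4), of "map_prod f h"] unfolding map_prod_surj_on[OF refl refl] .
  moreover have "p \<in> f ` S \<times> h ` T" using p ST(3) by simp
  ultimately show "\<exists>A B. open A \<and> open B \<and> p \<in> A \<times> B \<and> A \<times> B \<subseteq> map_prod f h ` V"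
    by (intro exI[of _ "f ` S"] exI[of _ "h ` T"] conjI f h ST)
qed

instance torus :: (finite) second_countable_topology
proof
  obtain D :: "(real ^ 'a) set set" where D: "countable D" "topological_basis D"
    using ex_countable_basis by blast
  have "topological_basis ((`) torus_proj ` D)"
  proof (rule topological_basisI)
    show "open B'" if "B' \<in> (`) torus_proj ` D" for B' :: "'a torus set"
      using that topological_basis_open[OF D(2)] by (auto intro: open_torus_proj_image)
    fix U :: "'a torus set" and y assume "open U" "y \<in> U"
    then obtain B where "B \<in> D" "rep_torus y \<in> B" "B \<subseteq> torus_proj -` U"
      using topological_basisE[OF D(2), of "torus_proj -` U" "rep_torus y"] by (auto simp: open_torus_def)
    then show "\<exists>B'\<in>(`) torus_proj ` D. y \<in> B' \<and> B' \<subseteq> U"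
      by (intro bexI[of _ "torus_proj ` B"]) (auto intro: image_eqI[of _ _ "rep_torus y"])
  qed
  then show "\<exists>B :: 'a torus set set. countable B \<and> open = generate_topology B"
    using D(1) topological_basis_imp_subbasis by blast
qed

lemma continuous_on_torusI:
  assumes "continuous_on UNIV (\<lambda>x. f (torus_proj x))"
  shows "continuous_on UNIV f"
  using assms unfolding continuous_on_open_vimage[OF open_UNIV]
  by (auto simp: open_torus_def vimage_def)

text \<open>Openness of the covering \<open>\<real>\<^sup>d \<rightarrow> \<real>\<^sup>d / \<int>\<^sup>d\<close> lets continuity be checked upstairs. The second argument
  is kept in \<open>\<real>\<^sup>d\<close> because the flow translates by the projection of a velocity vector.\<close>

lemma continuous_torus_translation:
  "continuous_on UNIV (\<lambda>(y :: 'd::finite torus, s). y + torus_proj s)"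
  unfolding continuous_on_open_vimage[OF open_UNIV]
proof safe
  fix B :: "'d torus set" assume "open B"
  let ?O = "(\<lambda>(x, s). x + s) -` (torus_proj -` B)"
  have "continuous_on UNIV (\<lambda>(x :: real ^ 'd, s). x + s)"
    unfolding split_beta by (intro continuous_intros)
  then have "open ?O"
    using \<open>open B\<close> unfolding open_torus_def continuous_on_open_vimage[OF open_UNIV] by simp
  moreover have "(\<lambda>(y, s). y + torus_proj s) -` B \<inter> UNIV = map_prod torus_proj id ` ?O"
  proof safe
    fix y :: "'d torus" and s assume "y + torus_proj s \<in> B"
    then show "(y, s) \<in> map_prod torus_proj id ` ?O"
      by (intro image_eqI[of _ _ "(rep_torus y, s)"]) (auto simp: torus_proj_add)
  qed (auto simp: torus_proj_add)
  ultimately show "open ((\<lambda>(y, s). y + torus_proj s) -` B \<inter> UNIV)"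
    using open_image_map_prod[of UNIV torus_proj UNIV id ?O] by (simp add: open_torus_proj_image)
qed

definition unit_cube :: "(real ^ 'd::finite) set"
  where "unit_cube = {x. \<forall>i. 0 \<le> x $ i \<and> x $ i < 1}"

lemma unit_cube_Borel [measurable]: "unit_cube \<in> sets borel"
  unfolding unit_cube_def by measurable

lemma unit_cube_tiling: "\<exists>!k. x - of_int_vec k \<in> unit_cube"
proof
  show "x - of_int_vec (\<chi> i. \<lfloor>x $ i\<rfloor>) \<in> unit_cube"
    by (auto simp: unit_cube_def of_int_vec_def) linarith+
  show "k = (\<chi> i. \<lfloor>x $ i\<rfloor>)" if "x - of_int_vec k \<in> unit_cube" for k
    using that by (auto simp: unit_cube_def of_int_vec_def vec_eq_iff) (smt (verit) floor_unique)
qed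

lemma emeasure_lborel_translate:
  fixes A :: "'a::euclidean_space set"
  assumes [measurable]: "A \<in> sets borel"
  shows "emeasure lborel {x. x + c \<in> A} = emeasure lborel A"
proof -
  have "emeasure lborel A = emeasure (distr lborel borel ((+) c)) A" by (simp add: lborel_distr_plus)
  also have "\<dots> = emeasure lborel {x. x + c \<in> A}"
    by (subst emeasure_distr) (auto simp: vimage_def add.commute)
  finally show ?thesis by simp
qed

text \<open>Any translate of the unit cube is a fundamental domain of the integer lattice and thus meets a
  periodic set in the same measure. The translated cube is cut along the lattice translates of the
  standard cube, and the pieces are moved back into the standard cube.\<close>

lemma emeasure_periodic_set_cube:
  fixes S :: "(real ^ 'd::finite) set"
  assumes [measurable]: "S \<in> sets borel" and per: "\<And>x k. x + of_int_vec k \<in> S \<longleftrightarrow> x \<in> S"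
  shows "emeasure lborel {x \<in> S. x - s \<in> unit_cube} = emeasure lborel (S \<inter> unit_cube)"
proof -
  define A where "A k = {x \<in> S. x - s \<in> unit_cube \<and> x - of_int_vec k \<in> unit_cube}" for k
  define B where "B k = {x \<in> S. x \<in> unit_cube \<and> x + of_int_vec k - s \<in> unit_cube}" for k
  have A_meas: "A k \<in> sets borel" for k unfolding A_def by measurable
  have B_meas: "B k \<in> sets borel" for k unfolding B_def by measurable
  have shift: "B k = {x. x + of_int_vec k \<in> A k}" for k
    by (auto simp: A_def B_def per algebra_simps)
  have A_UN: "{x \<in> S. x - s \<in> unit_cube} = (\<Union>k. A k)"
    unfolding A_def using unit_cube_tiling by blast
  have B_UN: "S \<inter> unit_cube = (\<Union>k. B k)"
  proof -
    have "\<exists>k. x + of_int_vec k - s \<in> unit_cube" for x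
    proof -
      obtain k where "x - s - of_int_vec k \<in> unit_cube" using unit_cube_tiling by blast
      then show ?thesis by (intro exI[of _ "-k"]) (simp add: of_int_vec_simps algebra_simps)
    qed
    then show ?thesis by (auto simp: B_def)
  qed
  have A_disj: "disjoint_family A"
    unfolding disjoint_family_on_def A_def using unit_cube_tiling by blast
  have B_disj: "disjoint_family B"
    unfolding disjoint_family_on_def
  proof safe
    fix k l x assume "k \<noteq> l" "x \<in> B k" "x \<in> B l"
    then have "x - s - of_int_vec (-k) \<in> unit_cube" "x - s - of_int_vec (-l) \<in> unit_cube"
      by (auto simp: B_def of_int_vec_simps algebra_simps)
    then have "-k = -l" using unit_cube_tiling by blast
    with \<open>k \<noteq> l\<close> show "x \<in> {}" by simp
  qed
  have "emeasure lborel (\<Union>k. A k) = (\<integral>\<^sup>+k. emeasure lborel (A k) \<partial>count_space UNIV)"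
    by (rule emeasure_UN_countable) (auto simp: A_meas A_disj)
  also have "\<dots> = (\<integral>\<^sup>+k. emeasure lborel (B k) \<partial>count_space UNIV)"
    unfolding shift by (simp add: emeasure_lborel_translate A_meas)
  also have "\<dots> = emeasure lborel (\<Union>k. B k)"
    by (rule emeasure_UN_countable[symmetric]) (auto simp: B_meas B_disj)
  finally show ?thesis unfolding A_UN B_UN .
qed

lemma torus_proj_Borel [measurable]: "torus_proj \<in> borel_measurable borel"
  by (rule borel_measurable_continuous_onI[OF continuous_torus_proj])

lemma sets_torus_lebesgue [simp, measurable_cong]: "sets torus_lebesgue = sets borel"
  by (simp add: torus_lebesgue_def)

lemma space_torus_lebesgue [simp]: "space torus_lebesgue = UNIV"
  by (simp add: torus_lebesgue_def)

lemma emeasure_torus_lebesgue: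
  assumes [measurable]: "B \<in> sets borel"
  shows "emeasure torus_lebesgue B = emeasure lborel (torus_proj -` B \<inter> unit_cube)"
proof -
  have "emeasure torus_lebesgue B
      = emeasure (restrict_space lborel unit_cube) (torus_proj -` B \<inter> unit_cube)"
    unfolding torus_lebesgue_def unit_cube_def[symmetric]
    by (subst emeasure_distr) (auto simp: space_restrict_space measurable_restrict_space1)
  also have "\<dots> = emeasure lborel (torus_proj -` B \<inter> unit_cube)"
    by (rule emeasure_restrict_space) auto
  finally show ?thesis .
qed

lemma torus_translation_Borel [measurable]: "(\<lambda>y. y + c) \<in> borel_measurable (borel :: 'd::finite torus measure)"
proof (rule borel_measurable_continuous_onI)
  have "continuous_on UNIV ((\<lambda>(y, s). y + torus_proj s) \<circ> (\<lambda>y. (y, rep_torus c)))"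
    by (intro continuous_on_compose continuous_intros continuous_on_subset[OF continuous_torus_translation]) auto
  then show "continuous_on UNIV (\<lambda>y. y + c)" by (simp add: comp_def)
qed

theorem torus_lebesgue_translation_invariant:
  assumes [measurable]: "B \<in> sets borel"
  shows "emeasure torus_lebesgue ((\<lambda>y. y + c) -` B) = emeasure torus_lebesgue B"
proof -
  define s where "s = rep_torus c"
  then have c: "c = torus_proj s" by simp
  have m: "(\<lambda>y. y + c) -` B \<in> sets borel"
    using measurable_sets[OF torus_translation_Borel assms, of c] by simp
  have S [measurable]: "torus_proj -` B \<in> sets borel"
    using measurable_sets[OF torus_proj_Borel assms] by simp
  have A: "{x \<in> torus_proj -` B. x - s \<in> unit_cube} \<in> sets borel" by measurable
  have "torus_proj -` (\<lambda>y. y + c) -` B \<inter> unit_cube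
      = {x. x + s \<in> {x \<in> torus_proj -` B. x - s \<in> unit_cube}}"
    by (auto simp: c torus_proj_add)
  then show ?thesis
    unfolding emeasure_torus_lebesgue[OF m] emeasure_torus_lebesgue[OF assms]
    using emeasure_lborel_translate[OF A, of s] emeasure_periodic_set_cube[OF S, of s] by simp
qed

lemma finite_measure_torus_lebesgue: "finite_measure (torus_lebesgue :: 'd::finite torus measure)"
proof
  have "emeasure lborel (unit_cube :: (real ^ 'd) set) \<le> emeasure lborel (cbox (0 :: real ^ 'd) (\<chi> i. 1))"
    by (rule emeasure_mono) (auto simp: unit_cube_def mem_box_cart less_imp_le)
  then have "emeasure lborel (unit_cube :: (real ^ 'd) set) < \<infinity>"
    using emeasure_lborel_cbox_finite le_less_trans by (metis infinity_ennreal_def)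
  then show "emeasure torus_lebesgue (space (torus_lebesgue :: 'd torus measure)) \<noteq> \<infinity>"
    by (simp add: emeasure_torus_lebesgue)
qed

text \<open>The real characters of the torus, with phase: \<open>c = 0\<close> and \<open>c = -\<pi>/2\<close> give the real and
  imaginary parts of \<open>exp (2\<pi>i\<langle>\<xi>, y\<rangle>)\<close>. The chosen representative of \<open>y\<close> is immaterial by the next
  lemma.\<close>

definition torus_wave :: "int ^ 'd \<Rightarrow> real \<Rightarrow> 'd::finite torus \<Rightarrow> real"
  where "torus_wave \<xi> c y = cos (2 * pi * (of_int_vec \<xi> \<bullet> rep_torus y) + c)"

lemma torus_wave_proj: "torus_wave \<xi> c (torus_proj x) = cos (2 * pi * (of_int_vec \<xi> \<bullet> x) + c)"
proof -
  obtain k where k: "rep_torus (torus_proj x) = x + of_int_vec k"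
    using torus_proj_rep[of "torus_proj x"] unfolding torus_proj_eq_iff by blast
  have "of_int_vec \<xi> \<bullet> of_int_vec k = real_of_int (\<Sum>i\<in>UNIV. \<xi> $ i * k $ i)"
    by (simp add: inner_vec_def of_int_vec_def)
  then have "torus_wave \<xi> c (torus_proj x)
      = cos ((2 * pi * (of_int_vec \<xi> \<bullet> x) + c) + 2 * pi * real_of_int (\<Sum>i\<in>UNIV. \<xi> $ i * k $ i))"
    by (simp add: torus_wave_def k inner_add_right algebra_simps)
  then show ?thesis by (simp only: cos_add cos_int_2pin sin_int_2pin) simp
qed

text \<open>Rotating the torus only changes the phase; this is what turns the flow into an oscillation.\<close>

lemma torus_wave_translate:
  "torus_wave \<xi> c (y + torus_proj s) = torus_wave \<xi> (c + 2 * pi * (of_int_vec \<xi> \<bullet> s)) y"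
  using torus_wave_proj[of \<xi> c "rep_torus y + s"]
  by (simp add: torus_proj_add torus_wave_def inner_add_right algebra_simps)

lemma torus_wave_bounded: "\<bar>torus_wave \<xi> c y\<bar> \<le> 1"
  by (simp add: torus_wave_def)

lemma torus_wave_Borel [measurable]: "torus_wave \<xi> c \<in> borel_measurable borel"
  by (rule borel_measurable_continuous_onI, rule continuous_on_torusI)
    (auto simp: torus_wave_proj intro!: continuous_intros)

lemma torus_wave_mult:
  "torus_wave \<xi> c y * torus_wave \<eta> d y
    = 1/2 * torus_wave (\<xi> - \<eta>) (c - d) y + 1/2 * torus_wave (\<xi> + \<eta>) (c + d) y"
  by (simp add: torus_wave_def cos_times_cos of_int_vec_simps inner_add_left inner_diff_left algebra_simps)

inductive trig_poly :: "('d::finite torus \<Rightarrow> real) \<Rightarrow> bool" where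
  wave: "trig_poly (\<lambda>y. a * torus_wave \<xi> c y)"
| add: "trig_poly p \<Longrightarrow> trig_poly q \<Longrightarrow> trig_poly (\<lambda>y. p y + q y)"

lemma trig_poly_const: "trig_poly (\<lambda>_. a)"
  using trig_poly.wave[of a 0 0] by (simp add: torus_wave_def of_int_vec_simps)

text \<open>The product formula for cosines keeps the waves stable under multiplication, so that polynomials
  in \<open>cos (2\<pi>x\<^sub>i)\<close> and \<open>sin (2\<pi>x\<^sub>i)\<close> are trigonometric polynomials.\<close>

lemma trig_poly_mult:
  assumes "trig_poly p" "trig_poly q"
  shows "trig_poly (\<lambda>y. p y * q y)"
  using assms(1)
proof induction
  case (wave a \<xi> c)
  show ?case using assms(2)
  proof induction
    case (wave b \<eta> d)
    have "a * torus_wave \<xi> c y * (b * torus_wave \<eta> d y)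
        = (a * b / 2) * torus_wave (\<xi> - \<eta>) (c - d) y + (a * b / 2) * torus_wave (\<xi> + \<eta>) (c + d) y" for y
    proof -
      have "a * torus_wave \<xi> c y * (b * torus_wave \<eta> d y) = (a * b) * (torus_wave \<xi> c y * torus_wave \<eta> d y)"
        by (simp add: algebra_simps)
      then show ?thesis unfolding torus_wave_mult by (simp add: algebra_simps)
    qed
    then show ?case by (simp only:) (intro trig_poly.intros)
  qed (simp add: distrib_left trig_poly.add)
qed (simp add: distrib_right trig_poly.add)

lemma trig_poly_sum:
  assumes "\<And>i. i \<in> J \<Longrightarrow> trig_poly (p i)"
  shows "trig_poly (\<lambda>y. \<Sum>i\<in>J. p i y)"
  using assms by (induction J rule: infinite_finite_induct) (auto intro: trig_poly_const trig_poly.add)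

text \<open>Induces an embedding of the torus into a Euclidean space, as a product of unit circles with
  cosines and sines collected separately.\<close>

definition circle_coords :: "real ^ 'd \<Rightarrow> (real ^ 'd) \<times> (real ^ 'd::finite)"
  where "circle_coords x = (\<chi> i. cos (2 * pi * x $ i), \<chi> i. sin (2 * pi * x $ i))"

lemma continuous_circle_coords: "continuous_on A circle_coords"
  unfolding circle_coords_def by (intro continuous_intros continuous_on_vec_lambda)

lemma circle_coords_eq_iff: "circle_coords x = circle_coords y \<longleftrightarrow> torus_proj x = torus_proj y"
proof
  assume "circle_coords x = circle_coords y"
  then have "sin (2 * pi * x $ i) = sin (2 * pi * y $ i) \<and> cos (2 * pi * x $ i) = cos (2 * pi * y $ i)" for i
    by (simp add: circle_coords_def vec_eq_iff)
  then have "\<exists>n::int. 2 * pi * x $ i = 2 * pi * y $ i + 2 * pi * n" for i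
    unfolding sin_cos_eq_iff .
  then have "\<exists>n::int. x $ i = y $ i + n" for i
    by (metis (no_types, opaque_lifting) distrib_left mult_cancel_left pi_neq_zero zero_neq_numeral mult_eq_0_iff)
  then obtain n where "\<And>i. x $ i = y $ i + real_of_int (n i)" by metis
  then have "x = y + of_int_vec (\<chi> i. n i)" by (simp add: vec_eq_iff of_int_vec_def)
  then show "torus_proj x = torus_proj y" by simp
next
  assume "torus_proj x = torus_proj y"
  then obtain k where k: "x = y + of_int_vec k" unfolding torus_proj_eq_iff by blast
  have "sin (2 * pi * x $ i) = sin (2 * pi * y $ i) \<and> cos (2 * pi * x $ i) = cos (2 * pi * y $ i)" for i
    unfolding sin_cos_eq_iff by (intro exI[of _ "k $ i"]) (simp add: k of_int_vec_def algebra_simps)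
  then show "circle_coords x = circle_coords y" by (simp add: circle_coords_def)
qed

lemma circle_coords_nonzero: "circle_coords x \<noteq> 0"
proof
  fix i
  assume "circle_coords x = 0"
  then have "cos (2 * pi * x $ i) = 0 \<and> sin (2 * pi * x $ i) = 0"
    by (simp add: circle_coords_def zero_prod_def vec_eq_iff)
  then show False using sin_cos_squared_add[of "2 * pi * x $ i"] by simp
qed

lemma of_int_vec_axis_inner: "of_int_vec (axis i 1) \<bullet> x = x $ i"
proof -
  have "of_int_vec (axis i 1) = axis i (1::real)"
    by (auto simp: of_int_vec_def axis_def vec_eq_iff)
  then show ?thesis by (simp add: inner_axis')
qed

lemma trig_poly_polynomial_circle_coords:
  fixes p :: "(real ^ 'd::finite) \<times> (real ^ 'd) \<Rightarrow> real"
  assumes "real_polynomial_function p"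
  shows "trig_poly (\<lambda>y. p (circle_coords (rep_torus y)))"
  using assms
proof induction
  case (linear f)
  have base: "trig_poly (\<lambda>y. circle_coords (rep_torus y) \<bullet> b)"
    if "b \<in> Basis" for b :: "(real ^ 'd) \<times> (real ^ 'd)"
  proof -
    from that consider i where "b = (axis i 1, 0)" | i where "b = (0, axis i 1)"
      by (auto simp: Basis_prod_def Basis_vec_def)
    then show ?thesis
    proof cases
      case (1 i)
      have "(\<lambda>y. circle_coords (rep_torus y) \<bullet> b) = (\<lambda>y. 1 * torus_wave (axis i 1) 0 y)"
        by (auto simp: 1 circle_coords_def inner_axis torus_wave_def of_int_vec_axis_inner)
      then show ?thesis by (simp only: trig_poly.wave)
    next
      case (2 i)
      have "(\<lambda>y. circle_coords (rep_torus y) \<bullet> b) = (\<lambda>y. 1 * torus_wave (axis i 1) (-(pi/2)) y)"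
        by (auto simp: 2 circle_coords_def inner_axis torus_wave_def of_int_vec_axis_inner cos_diff
            simp flip: diff_conv_add_uminus)
      then show ?thesis by (simp only: trig_poly.wave)
    qed
  qed
  have "f u = (\<Sum>b\<in>Basis. (u \<bullet> b) * f b)" for u
  proof -
    have "f u = f (\<Sum>b\<in>Basis. (u \<bullet> b) *\<^sub>R b)" by (simp add: euclidean_representation)
    also have "\<dots> = (\<Sum>b\<in>Basis. (u \<bullet> b) * f b)"
      using bounded_linear.linear[OF linear] by (simp add: linear_sum linear_scale)
    finally show ?thesis .
  qed
  then have "(\<lambda>y. f (circle_coords (rep_torus y)))
      = (\<lambda>y. \<Sum>b\<in>Basis. (circle_coords (rep_torus y) \<bullet> b) * f b)" by blast
  then show ?case by (simp only:) (intro trig_poly_sum trig_poly_mult base trig_poly_const)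
qed (auto intro: trig_poly_const trig_poly.add trig_poly_mult)

text \<open>On the embedded torus, the indicator of an open set is the pointwise limit of truncated multiples
  of the distance to the complement. These are continuous functions on a compact set of a Euclidean
  space, so the Stone--Weierstrass theorem replaces them by polynomials, which restrict to
  trigonometric polynomials.\<close>

theorem trig_poly_approximates_open:
  assumes "open (B :: 'd::finite torus set)"
  obtains p where "\<And>n::nat. trig_poly (p n)" "\<And>n y. \<bar>p n y\<bar> \<le> 2"
    "\<And>y. (\<lambda>n. p n y) \<longlonglongrightarrow> indicator B y"
proof -
  let ?E = "circle_coords :: real ^ 'd \<Rightarrow> _"
  let ?I = "cbox (0 :: real ^ 'd) (\<chi> i. 1)"
  \<comment> \<open>the origin lies off the embedded torus; it keeps \<open>C\<close> nonempty, so that \<open>infdist\<close> is a true distance\<close>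
  define C where "C = insert 0 (?E ` (?I \<inter> torus_proj -` (- B)))"
  have "closed (torus_proj -` (- B) :: (real ^ 'd) set)"
    using assms by (simp add: open_torus_def closed_def vimage_Compl)
  then have "compact (?E ` (?I \<inter> torus_proj -` (- B)))"
    by (intro compact_continuous_image continuous_circle_coords compact_Int_closed) auto
  then have C: "closed C" "C \<noteq> {}"
    unfolding C_def by (auto intro: compact_imp_closed)
  have rep: "\<exists>x\<in>?I. torus_proj x = y" for y :: "'d torus"
  proof -
    obtain k where "rep_torus y - of_int_vec k \<in> unit_cube" using unit_cube_tiling by blast
    moreover have "torus_proj (rep_torus y - of_int_vec k) = y"
      using torus_proj_add_int[of "rep_torus y - of_int_vec k" k] by simp
    ultimately show ?thesis
      by (intro bexI[of _ "rep_torus y - of_int_vec k"]) (auto simp: unit_cube_def mem_box_cart less_imp_le)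
  qed
  define f where "f n u = min 1 (real n * infdist u C)" for n u
  have f_cont: "continuous_on (?E ` ?I) (f n)" for n
    unfolding f_def by (intro continuous_intros)
  have "\<exists>q. real_polynomial_function q \<and> (\<forall>u\<in>?E ` ?I. \<bar>f n u - q u\<bar> < 1 / (real n + 1))" for n
  proof -
    have "compact (?E ` ?I)" by (intro compact_continuous_image continuous_circle_coords) auto
    then obtain r where "real_polynomial_function r"
      "\<And>u. u \<in> ?E ` ?I \<Longrightarrow> \<bar>f n u - r u\<bar> < 1 / (real n + 1)"
      by (rule Stone_Weierstrass_real_polynomial_function[OF _ f_cont, of "1 / (real n + 1)"]) auto
    then show ?thesis by blast
  qed
  then obtain q where q: "\<And>n. real_polynomial_function (q n)"
    and fq: "\<And>n u. u \<in> ?E ` ?I \<Longrightarrow> \<bar>f n u - q n u\<bar> < 1 / (real n + 1)" by metis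
  define p where "p n y = q n (?E (rep_torus y))" for n y
  have mem: "?E (rep_torus y) \<in> ?E ` ?I" for y
  proof -
    obtain x where "x \<in> ?I" "torus_proj x = y" using rep by blast
    then have "?E x = ?E (rep_torus y)" by (simp add: circle_coords_eq_iff)
    with \<open>x \<in> ?I\<close> show ?thesis by (metis imageI)
  qed
  have close: "\<bar>f n (?E (rep_torus y)) - p n y\<bar> < 1 / (real n + 1)" for n y
    unfolding p_def by (rule fq[OF mem])
  have f01: "0 \<le> f n u" "f n u \<le> 1" for n u
    by (auto simp: f_def infdist_nonneg)
  have "\<bar>p n y\<bar> \<le> 2" for n y
  proof -
    have "1 / (real n + 1) \<le> 1" by simp
    with close[of n y] f01[of n "?E (rep_torus y)"] show ?thesis by linarith
  qed
  moreover have "(\<lambda>n. p n y) \<longlonglongrightarrow> indicator B y" for y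
  proof -
    let ?u = "?E (rep_torus y)"
    have C_iff: "?u \<in> C \<longleftrightarrow> y \<notin> B"
    proof
      assume "?u \<in> C"
      then obtain x where "?u = ?E x" "torus_proj x \<notin> B"
        unfolding C_def using circle_coords_nonzero by auto
      then show "y \<notin> B" unfolding circle_coords_eq_iff by simp
    next
      assume "y \<notin> B"
      obtain x where x: "x \<in> ?I" "torus_proj x = y" using rep by blast
      then have "?u = ?E x" by (simp add: circle_coords_eq_iff)
      with x \<open>y \<notin> B\<close> show "?u \<in> C" unfolding C_def by auto
    qed
    have f_lim: "(\<lambda>n. f n ?u) \<longlonglongrightarrow> indicator B y"
    proof (cases "y \<in> B")
      case True
      then have pos: "0 < infdist ?u C"
        using C C_iff infdist_pos_not_in_closed by blast
      have "\<forall>\<^sub>F n in sequentially. f n ?u = 1"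
        using eventually_ge_at_top[of "nat \<lceil>1 / infdist ?u C\<rceil>"]
      proof eventually_elim
        case (elim n)
        then have "1 / infdist ?u C \<le> real n" by linarith
        with pos show ?case by (simp add: f_def field_simps)
      qed
      with True show ?thesis by (auto intro: tendsto_eventually)
    next
      case False
      with C_iff show ?thesis by (simp add: f_def)
    qed
    have "(\<lambda>n. p n y - f n ?u) \<longlonglongrightarrow> 0"
    proof (rule Lim_null_comparison)
      show "\<forall>\<^sub>F n in sequentially. norm (p n y - f n ?u) \<le> 1 / (real n + 1)"
        using close[of _ y] by (intro always_eventually allI) (simp add: abs_minus_commute less_imp_le)
      show "(\<lambda>n. 1 / (real n + 1)) \<longlonglongrightarrow> 0"
        using LIMSEQ_inverse_real_of_nat by (simp add: inverse_eq_divide add.commute)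
    qed
    from tendsto_add[OF this f_lim] show ?thesis by simp
  qed
  moreover have "trig_poly (p n)" for n
    using trig_poly_polynomial_circle_coords[OF q] by (simp add: p_def[abs_def])
  ultimately show ?thesis using that[of p] by blast
qed

section \<open>Null sets on manifolds and bundles\<close>

text \<open>Near a point where its derivative is nonzero, \<open>u\<close> shrinks distances to that point at most by some
  factor \<open>k\<close>. Hence
  \<open>S\<close> is a countable union of pieces on which \<open>u\<close> has a Lipschitz inverse, and each piece is a
  Lipschitz image of a subset of \<open>N\<close>.\<close>

lemma negligible_nonsingular_preimage_real:
  fixes u :: "real \<Rightarrow> real"
  assumes N: "negligible N" and uN: "\<And>s. s \<in> S \<Longrightarrow> u s \<in> N"
    and der: "\<And>s. s \<in> S \<Longrightarrow> (u has_real_derivative u' s) (at s)" and nz: "\<And>s. s \<in> S \<Longrightarrow> u' s \<noteq> 0"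
  shows "negligible S"
proof -
  \<comment> \<open>the floor confines a piece to an interval of length \<open>1 / k\<close>, where the expansion bound is available\<close>
  define P where "P k j = {s \<in> S. \<lfloor>real k * s\<rfloor> = j \<and> (\<forall>s'. \<bar>s' - s\<bar> < 2 / real k \<longrightarrow> \<bar>s' - s\<bar> \<le> real k * \<bar>u s' - u s\<bar>)}"
    for k :: nat and j :: int
  have "negligible (P k j)" if "0 < k" for k j
  proof -
    have expand: "\<bar>s' - s\<bar> \<le> real k * \<bar>u s' - u s\<bar>" if "s \<in> P k j" "s' \<in> P k j" for s s'
    proof -
      have "\<bar>real k * s' - real k * s\<bar> < 1"
        using that unfolding P_def by (simp add: floor_eq_iff) linarith
      then have "real k * \<bar>s' - s\<bar> < 1" by (simp add: abs_mult flip: right_diff_distrib)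
      then have "\<bar>s' - s\<bar> < 2 / real k" using \<open>0 < k\<close> by (simp add: field_simps)
      then show ?thesis using that unfolding P_def by blast
    qed
    then have inj: "inj_on u (P k j)"
      by (intro inj_onI) (metis abs_le_zero_iff diff_self eq_iff_diff_eq_0 mult_zero_right abs_zero)
    have "negligible (inv_into (P k j) u ` (u ` P k j))"
    proof (rule negligible_locally_Lipschitz_image)
      show "negligible (u ` P k j)"
        by (rule negligible_subset[OF N]) (use uN in \<open>auto simp: P_def\<close>)
      fix r assume "r \<in> u ` P k j"
      then show "\<exists>T B. open T \<and> r \<in> T \<and> (\<forall>r'\<in>u ` P k j \<inter> T.
          norm (inv_into (P k j) u r' - inv_into (P k j) u r) \<le> B * norm (r' - r))"
        using expand by (intro exI[of _ UNIV] exI[of _ "real k"]) (auto simp: inv_into_f_f[OF inj])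
    qed simp
    moreover have "inv_into (P k j) u ` (u ` P k j) = P k j"
      using inj by (simp add: inv_into_image_cancel)
    ultimately show ?thesis by simp
  qed
  moreover have "S \<subseteq> (\<Union>k\<in>{0<..}. \<Union>j. P k j)"
  proof
    fix s assume s: "s \<in> S"
    obtain d where "0 < d" and d: "\<And>s'. \<bar>s' - s\<bar> < d \<Longrightarrow> \<bar>u s' - u s - u' s * (s' - s)\<bar> \<le> \<bar>u' s\<bar> / 2 * \<bar>s' - s\<bar>"
      using der[OF s] nz[OF s] unfolding has_field_derivative_def has_derivative_at_alt
      by (force dest: spec[of _ "\<bar>u' s\<bar> / 2"])
    obtain k :: nat where k: "2 / d + 2 / \<bar>u' s\<bar> < real k" using reals_Archimedean2 by blast
    have "0 < 2 / d" "0 < 2 / \<bar>u' s\<bar>" using \<open>0 < d\<close> nz[OF s] by auto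
    with k have "0 < real k" "2 / d < real k" "2 / \<bar>u' s\<bar> < real k" by linarith+
    then have k': "2 / real k < d" "2 < real k * \<bar>u' s\<bar>" "0 < k"
      using \<open>0 < d\<close> nz[OF s] by (auto simp: field_simps)
    have "\<bar>s' - s\<bar> \<le> real k * \<bar>u s' - u s\<bar>" if "\<bar>s' - s\<bar> < 2 / real k" for s'
    proof -
      have "\<bar>u' s\<bar> * \<bar>s' - s\<bar> \<le> \<bar>u s' - u s\<bar> + \<bar>u' s\<bar> / 2 * \<bar>s' - s\<bar>"
      proof -
        have "\<bar>u' s * (s' - s)\<bar> \<le> \<bar>u s' - u s\<bar> + \<bar>u s' - u s - u' s * (s' - s)\<bar>" by linarith
        with d[OF less_trans[OF that k'(1)]] show ?thesis unfolding abs_mult by linarith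
      qed
      then have "\<bar>u' s\<bar> * \<bar>s' - s\<bar> \<le> 2 * \<bar>u s' - u s\<bar>" by simp
      then have "real k * (\<bar>u' s\<bar> * \<bar>s' - s\<bar>) \<le> real k * (2 * \<bar>u s' - u s\<bar>)"
        by (rule mult_left_mono) simp
      moreover have "2 * \<bar>s' - s\<bar> \<le> real k * \<bar>u' s\<bar> * \<bar>s' - s\<bar>"
        using k'(2) by (intro mult_right_mono) auto
      ultimately show ?thesis by (simp add: mult.assoc)
    qed
    then have "s \<in> P k \<lfloor>real k * s\<rfloor>" using s by (simp add: P_def)
    with \<open>0 < k\<close> show "s \<in> (\<Union>k\<in>{0<..}. \<Union>j. P k j)" by blast
  qed
  moreover have "negligible (\<Union>k\<in>{0<..}. \<Union>j. P k j)"
    using calculation(1) by (intro negligible_countable_Union) (auto intro!: negligible_countable_Union)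
  ultimately show ?thesis using negligible_subset by blast
qed

lemma borel_preimage_continuous_on:
  assumes "continuous_on V f" "V \<in> sets borel" "N \<in> sets borel"
  shows "{x \<in> V. f x \<in> N} \<in> sets borel"
proof -
  have "f -` N \<inter> space (restrict_space borel V) \<in> sets (restrict_space borel V)"
    by (rule measurable_sets[OF borel_measurable_continuous_on_restrict]) fact+
  then have "f -` N \<inter> V \<in> sets borel"
    using assms(2) by (simp add: sets_restrict_space_iff space_restrict_space)
  then show ?thesis by (simp add: vimage_def Int_def conj_commute)
qed

text \<open>Let \<open>E b\<close> be the part where the derivative in the basis direction \<open>b\<close> does not vanish. Every line
  in direction \<open>b\<close> meets \<open>E b\<close> in a null set by the one-dimensional case. Integrating the measure of
  \<open>{s. x + s b \<in> E b}\<close> over all \<open>x\<close> therefore gives \<open>0\<close>, whereas, with the integrations exchanged,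
  it gives the measure of \<open>E b\<close> infinitely often.\<close>

lemma null_nonsingular_preimage:
  fixes w :: "'a::euclidean_space \<Rightarrow> real" and w' :: "'a \<Rightarrow> 'a \<Rightarrow>\<^sub>L real"
  assumes V: "open V" and der: "\<And>x. x \<in> V \<Longrightarrow> (w has_derivative blinfun_apply (w' x)) (at x)"
    and cont: "continuous_on V w'" and N: "N \<in> null_sets lborel"
  shows "{x \<in> V. w x \<in> N \<and> w' x \<noteq> 0} \<in> null_sets lborel"
proof -
  define E where "E b = {x \<in> V. w x \<in> N \<and> w' x b \<noteq> 0}" for b
  have "continuous_on V w"
    using der by (intro continuous_at_imp_continuous_on) (auto intro: has_derivative_continuous)
  then have E1: "{x \<in> V. w x \<in> N} \<in> sets borel"
    using N V by (intro borel_preimage_continuous_on) auto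
  have E_Borel [measurable]: "E b \<in> sets borel" for b
  proof -
    have "continuous_on V (\<lambda>x. w' x b)" by (intro continuous_intros cont)
    then have "{x \<in> V. w' x b \<in> - {0}} \<in> sets borel"
      using V by (intro borel_preimage_continuous_on) auto
    from sets.Int[OF E1 this] show ?thesis
      by (rule back_subst[of "\<lambda>X. X \<in> sets borel"]) (auto simp: E_def)
  qed
  have "E b \<in> null_sets lborel" for b
  proof -
    have line: "emeasure lborel {s. x + s *\<^sub>R b \<in> E b} = 0" for x
    proof -
      have "negligible {s. x + s *\<^sub>R b \<in> E b}"
      proof (rule negligible_nonsingular_preimage_real[of N _ "\<lambda>s. w (x + s *\<^sub>R b)" "\<lambda>s. w' (x + s *\<^sub>R b) b"])
        show "negligible N" using N by (simp add: negligible_iff_null_sets null_sets_completionI)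
        fix s assume "s \<in> {s. x + s *\<^sub>R b \<in> E b}"
        then have s: "x + s *\<^sub>R b \<in> V" by (simp add: E_def)
        have "((\<lambda>s. w (x + s *\<^sub>R b)) has_derivative (\<lambda>h. w' (x + s *\<^sub>R b) (h *\<^sub>R b))) (at s)"
          by (rule has_derivative_compose[where f = "\<lambda>s. x + s *\<^sub>R b" and g = w, OF _ der[OF s]])
              (auto intro!: derivative_eq_intros)
        then show "((\<lambda>s. w (x + s *\<^sub>R b)) has_real_derivative w' (x + s *\<^sub>R b) b) (at s)"
          by (simp add: has_field_derivative_def blinfun.scaleR_right mult.commute[of _ "w' (x + s *\<^sub>R b) b"])
      qed (auto simp: E_def)
      moreover have "{s. x + s *\<^sub>R b \<in> E b} \<in> sets borel" by measurable
      ultimately show ?thesis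
        by (intro null_setsD1) (simp add: negligible_iff_null_sets null_sets_completion_iff)
    qed
    have "(\<integral>\<^sup>+s. emeasure lborel (E b) \<partial>(lborel :: real measure))
        = (\<integral>\<^sup>+s. \<integral>\<^sup>+x. indicator (E b) (x + s *\<^sub>R b) \<partial>lborel \<partial>(lborel :: real measure))"
    proof (rule nn_integral_cong)
      fix s :: real
      have "(\<integral>\<^sup>+x. indicator (E b) (x + s *\<^sub>R b) \<partial>lborel)
          = (\<integral>\<^sup>+x. indicator {x. x + s *\<^sub>R b \<in> E b} x \<partial>lborel)"
        by (intro nn_integral_cong) (simp split: split_indicator)
      also have "\<dots> = emeasure lborel {x. x + s *\<^sub>R b \<in> E b}" by (rule nn_integral_indicator) measurable
      finally show "emeasure lborel (E b) = (\<integral>\<^sup>+x. indicator (E b) (x + s *\<^sub>R b) \<partial>lborel)"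
        by (simp add: emeasure_lborel_translate)
    qed
    also have "\<dots> = (\<integral>\<^sup>+x. \<integral>\<^sup>+s. indicator (E b) (x + s *\<^sub>R b) \<partial>(lborel :: real measure) \<partial>lborel)"
      by (rule lborel_pair.Fubini') measurable
    also have "\<dots> = (\<integral>\<^sup>+x. emeasure lborel {s. x + s *\<^sub>R b \<in> E b} \<partial>lborel)"
    proof (rule nn_integral_cong)
      fix x
      have "(\<integral>\<^sup>+s. indicator (E b) (x + s *\<^sub>R b) \<partial>(lborel :: real measure))
          = (\<integral>\<^sup>+s. indicator {s. x + s *\<^sub>R b \<in> E b} s \<partial>lborel)"
        by (intro nn_integral_cong) (simp split: split_indicator)
      also have "\<dots> = emeasure lborel {s. x + s *\<^sub>R b \<in> E b}" by (rule nn_integral_indicator) measurable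
      finally show "(\<integral>\<^sup>+s. indicator (E b) (x + s *\<^sub>R b) \<partial>lborel) = emeasure lborel {s. x + s *\<^sub>R b \<in> E b}" .
    qed
    finally have "emeasure lborel (E b) * \<infinity> = 0" by (simp add: line)
    then show ?thesis by (auto simp: ennreal_mult_eq_top_iff)
  qed
  then have "(\<Union>b\<in>Basis. E b) \<in> null_sets lborel" by (intro null_sets_UN') (auto simp: countable_finite)
  moreover have "{x \<in> V. w x \<in> N \<and> w' x \<noteq> 0} = (\<Union>b\<in>Basis. E b)"
    unfolding E_def by (auto intro: blinfun_euclidean_eqI)
  ultimately show ?thesis by simp
qed

lemma chartD:
  assumes "c1_atlas \<A>" "(U, \<phi>) \<in> \<A>"
  shows "open U" "continuous_on U \<phi>" "inj_on \<phi> U"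
    "\<And>S. open S \<Longrightarrow> S \<subseteq> U \<Longrightarrow> open (\<phi> ` S)"
proof -
  have U: "open U" "open (\<phi> ` U)" and h: "homeomorphism U (\<phi> ` U) \<phi> (inv_into U \<phi>)"
    using assms by (auto simp: c1_atlas_def)
  show "open U" "continuous_on U \<phi>" using U h by (auto simp: homeomorphism_def)
  show "inj_on \<phi> U" using h by (metis homeomorphism_apply1 inj_on_inverseI)
  fix S assume S: "open S" "S \<subseteq> U"
  then have "openin (top_of_set (\<phi> ` U)) (\<phi> ` S)"
    by (intro homeomorphism_imp_open_map[OF h]) (simp add: open_openin_trans openin_open_eq U)
  then show "open (\<phi> ` S)" using U(2) openin_open_eq by blast
qed

lemma chart_domain_open: "chart_domain \<A> U \<Longrightarrow> open U"
  unfolding chart_domain_def by (auto intro: chartD(1))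

text \<open>By the chain rule for the changes of charts.\<close>

lemma differential_vanishes_if_chart:
  assumes atlas: "c1_atlas \<A>" and U: "(U, \<phi>) \<in> \<A>" "x \<in> U"
    and zero: "((f \<circ> inv_into U \<phi>) has_derivative (\<lambda>_. 0)) (at (\<phi> x))"
  shows "differential_vanishes \<A> f x"
  unfolding differential_vanishes_def
proof safe
  fix V \<eta> assume V: "(V, \<eta>) \<in> \<A>" "x \<in> V"
  note cU = chartD[OF atlas U(1)] and cV = chartD[OF atlas V(1)]
  have "c1_on (\<phi> \<circ> inv_into V \<eta>) (\<eta> ` (V \<inter> U))"
    using atlas U(1) V(1) unfolding c1_atlas_def by fast
  then obtain D where D: "((\<phi> \<circ> inv_into V \<eta>) has_derivative D) (at (\<eta> x))"
    unfolding c1_on_def using U V by blast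
  have \<eta>x: "(\<phi> \<circ> inv_into V \<eta>) (\<eta> x) = \<phi> x"
    using V(2) by (simp add: inv_into_f_f[OF cV(3)])
  have "((\<lambda>p. (f \<circ> inv_into U \<phi>) ((\<phi> \<circ> inv_into V \<eta>) p)) has_derivative (\<lambda>h. 0)) (at (\<eta> x))"
    by (rule has_derivative_compose[OF D, of "f \<circ> inv_into U \<phi>" "\<lambda>_. 0"]) (simp add: zero \<eta>x[simplified])
  then show "((f \<circ> inv_into V \<eta>) has_derivative (\<lambda>_. 0)) (at (\<eta> x))"
  proof (rule has_derivative_transform_within_open)
    show "open (\<eta> ` (U \<inter> V))" using cU(1) cV(1) by (intro cV(4)) auto
    show "\<eta> x \<in> \<eta> ` (U \<inter> V)" using U V by blast
    show "(f \<circ> inv_into U \<phi>) ((\<phi> \<circ> inv_into V \<eta>) p) = (f \<circ> inv_into V \<eta>) p" if "p \<in> \<eta> ` (U \<inter> V)" for p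
      using that by (auto simp: inv_into_f_f[OF cV(3)] inv_into_f_f[OF cU(3)])
  qed
qed

text \<open>The set of critical points is handled by \<open>R\<close>, its complement by \<open>null_nonsingular_preimage\<close>.\<close>

lemma manifold_null_set_level:
  assumes atlas: "c1_atlas \<A>" and U: "open U"
    and c1: "\<And>V \<eta>. (V, \<eta>) \<in> \<A> \<Longrightarrow> c1_on (f \<circ> inv_into V \<eta>) (\<eta> ` (U \<inter> V))"
    and R: "manifold_null_set \<A> R" "\<And>x. x \<in> U \<Longrightarrow> differential_vanishes \<A> f x \<Longrightarrow> x \<in> R"
    and N: "N \<in> null_sets lborel"
  shows "manifold_null_set \<A> {x \<in> U. f x \<in> N}"
  unfolding manifold_null_set_def
proof safe
  fix V \<eta> assume V: "(V, \<eta>) \<in> \<A>"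
  note cV = chartD[OF atlas V]
  let ?O = "\<eta> ` (U \<inter> V)" and ?w = "f \<circ> inv_into V \<eta>"
  obtain w' where der: "\<And>p. p \<in> ?O \<Longrightarrow> (?w has_derivative blinfun_apply (w' p)) (at p)"
    and cont: "continuous_on ?O w'"
    using c1[OF V] unfolding c1_on_def by blast
  have "open ?O" using U cV(1) by (intro cV(4)) auto
  from null_nonsingular_preimage[OF this der cont N]
  have "{p \<in> ?O. ?w p \<in> N \<and> w' p \<noteq> 0} \<in> null_sets lebesgue"
    by (simp add: null_sets_completionI)
  moreover have "\<eta> ` (R \<inter> V) \<in> null_sets lebesgue" using R(1) V by (auto simp: manifold_null_set_def)
  ultimately have "{p \<in> ?O. ?w p \<in> N \<and> w' p \<noteq> 0} \<union> \<eta> ` (R \<inter> V) \<in> null_sets lebesgue"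
    by (rule null_sets.Un)
  moreover have "\<eta> ` ({x \<in> U. f x \<in> N} \<inter> V) \<subseteq> {p \<in> ?O. ?w p \<in> N \<and> w' p \<noteq> 0} \<union> \<eta> ` (R \<inter> V)"
  proof safe
    fix x assume x: "x \<in> U" "f x \<in> N" "x \<in> V" "\<eta> x \<notin> \<eta> ` (R \<inter> V)"
    show "?w (\<eta> x) \<in> N" using x by (simp add: inv_into_f_f[OF cV(3)])
    assume "w' (\<eta> x) = 0"
    then have "(?w has_derivative (\<lambda>_. 0)) (at (\<eta> x))" using der[of "\<eta> x"] x by (simp add: zero_blinfun.rep_eq)
    then have "x \<in> R" using differential_vanishes_if_chart[OF atlas V x(3)] R(2) x(1) by blast
    with x show False by blast
  qed auto
  ultimately show "\<eta> ` ({x \<in> U. f x \<in> N} \<inter> V) \<in> null_sets lebesgue"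
    by (rule null_sets_completion_subset[rotated])
qed

lemma continuous_on_blinfun_compose_const:
  "continuous_on S f' \<Longrightarrow> continuous_on S (\<lambda>x. A o\<^sub>L f' x)"
  using bounded_linear.continuous_on[OF bounded_bilinear.bounded_linear_right[OF bounded_bilinear_blinfun_compose]] .

lemma c1_on_inner:
  assumes "c1_on f S"
  shows "c1_on (\<lambda>x. a \<bullet> f x) S"
proof -
  obtain f' where f': "\<And>x. x \<in> S \<Longrightarrow> (f has_derivative blinfun_apply (f' x)) (at x)" "continuous_on S f'"
    using assms unfolding c1_on_def by blast
  have "continuous_on S (\<lambda>x. blinfun_inner_right a o\<^sub>L f' x)"
    using f'(2) by (rule continuous_on_blinfun_compose_const)
  moreover have "((\<lambda>x. a \<bullet> f x) has_derivative blinfun_apply (blinfun_inner_right a o\<^sub>L f' x)) (at x)"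
    if "x \<in> S" for x
  proof -
    have "blinfun_apply (blinfun_inner_right a o\<^sub>L f' x) = (\<lambda>h. a \<bullet> f' x h)"
      by (rule ext) (simp add: blinfun_inner_right.rep_eq)
    with has_derivative_inner_right[OF f'(1)[OF that], of a] show ?thesis by simp
  qed
  ultimately show ?thesis
    unfolding c1_on_def by (intro exI[of _ "\<lambda>x. blinfun_inner_right a o\<^sub>L f' x"]) simp
qed

lemma negligible_Times_UNIV:
  fixes A :: "'a::euclidean_space set"
  assumes "A \<in> null_sets lebesgue"
  shows "negligible (A \<times> (UNIV :: 'b::euclidean_space set))"
proof -
  obtain N where N: "N \<in> null_sets lborel" "A \<subseteq> N"
    using assms unfolding null_sets_completion_iff2 by blast
  then have [measurable]: "N \<in> sets borel" by auto
  have "emeasure (lborel \<Otimes>\<^sub>M lborel) (N \<times> (UNIV :: 'b set)) = 0"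
    using N by (subst lborel.emeasure_pair_measure_Times) auto
  then have "N \<times> (UNIV :: 'b set) \<in> null_sets lborel"
    unfolding lborel_prod by (intro null_setsI) (auto simp: borel_prod[symmetric])
  then have "negligible (N \<times> (UNIV :: 'b set))"
    by (simp add: negligible_iff_null_sets null_sets_completionI)
  then show ?thesis by (rule negligible_subset) (use N in auto)
qed

lemma inj_on_torus_proj_ball: "inj_on torus_proj (ball x (1/2))"
proof (rule inj_onI)
  fix a b assume ab: "a \<in> ball x (1/2)" "b \<in> ball x (1/2)" "torus_proj a = torus_proj b"
  then obtain k where k: "a = b + of_int_vec k" unfolding torus_proj_eq_iff by blast
  have "dist a b < 1" using ab(1,2) dist_triangle_half_r[of x a 1 b] by (simp add: dist_commute)
  then have "norm (of_int_vec k) < 1" by (simp add: k dist_norm)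
  then have "real_of_int \<bar>k $ i\<bar> < 1" for i
    using component_le_norm_cart[of "of_int_vec k" i] by (simp add: of_int_vec_def)
  then have "\<bar>k $ i\<bar> < 1" for i unfolding of_int_less_1_iff .
  then have "k = 0" by (simp add: vec_eq_iff)
  then show "a = b" by (simp add: k of_int_vec_simps)
qed

text \<open>In charts the bundle is a product near \<open>z\<close>: the preimage of \<open>S\<close> is the image of \<open>\<eta>(S) \<times> \<real>\<^sup>d\<close>, a null
  set of \<open>\<real>\<^sup>n \<times> \<real>\<^sup>d\<close>, under a \<open>C\<^sup>1\<close> map \<open>F\<close> into the model space of the total space. A \<open>C\<^sup>1\<close> map sends
  null sets to null sets if its target has at least the dimension of its source; here invariance of
  domain supplies this, since \<open>F\<close> is injective and continuous on an open set.\<close>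

lemma manifold_null_set_vimage_local:
  fixes \<A>\<^sub>\<Omega> :: "('o::topological_space, 'e::euclidean_space) chart set"
    and \<A>\<^sub>M :: "('m::topological_space, real ^ 'n) chart set"
    and \<psi> :: "'o \<Rightarrow> 'm \<times> 'd::finite torus"
  assumes \<Omega>: "c1_atlas \<A>\<^sub>\<Omega>" and M: "c1_atlas \<A>\<^sub>M" and \<pi>: "continuous_on UNIV \<pi>"
    and triv: "local_trivialization \<A>\<^sub>\<Omega> \<A>\<^sub>M \<pi> (U, \<psi>)" and S: "manifold_null_set \<A>\<^sub>M S"
    and W: "(W, \<phi>) \<in> \<A>\<^sub>\<Omega>" and z: "z \<in> W" "\<pi> z \<in> U"
  obtains G where "open G" "z \<in> G" "negligible (\<phi> ` (\<pi> -` S \<inter> W \<inter> G))"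
proof -
  have U: "open U" using triv by (auto simp: local_trivialization_def intro: chart_domain_open)
  define \<theta> where "\<theta> = inv_into (\<pi> -` U) \<psi>"
  have bij: "bij_betw \<psi> (\<pi> -` U) (U \<times> UNIV)" and c1: "c1_map_on \<A>\<^sub>\<Omega> (prod_atlas \<A>\<^sub>M torus_atlas) (\<pi> -` U) \<psi>"
    and c1': "c1_map_on (prod_atlas \<A>\<^sub>M torus_atlas) \<A>\<^sub>\<Omega> (U \<times> UNIV) \<theta>"
    and fst: "\<And>z. \<pi> z \<in> U \<Longrightarrow> fst (\<psi> z) = \<pi> z"
    using triv by (auto simp: local_trivialization_def c1_diffeomorphism_def \<theta>_def)
  have \<theta>\<psi>: "\<theta> (\<psi> z) = z" if "\<pi> z \<in> U" for z
    unfolding \<theta>_def using bij that by (simp add: bij_betw_def inv_into_f_f)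
  have \<theta>_inj: "inj_on \<theta> (U \<times> UNIV)"
    using bij unfolding \<theta>_def by (metis bij_betw_def inj_on_inv_into subset_refl)
  obtain U' \<eta> where U': "(U', \<eta>) \<in> \<A>\<^sub>M" "\<pi> z \<in> U'" using M unfolding c1_atlas_def by fast
  \<comment> \<open>a ball of diameter one contains no two points that differ by a nonzero integer vector\<close>
  define B where "B = ball (rep_torus (snd (\<psi> z))) (1/2)"
  define \<tau> where "\<tau> = inv_into B torus_proj"
  have B: "open B" "inj_on torus_proj B" unfolding B_def by (auto intro: inj_on_torus_proj_ball)
  let ?T = "torus_proj ` B"
  have \<tau>: "\<tau> y \<in> B" "torus_proj (\<tau> y) = y" if "y \<in> ?T" for y
    using that unfolding \<tau>_def by (auto simp: inv_into_into f_inv_into_f)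
  have inj_chart: "inj_on (map_prod \<eta> \<tau>) (U' \<times> ?T)"
    using chartD(3)[OF M U'(1)] by (intro map_prod_inj_on) (auto simp: \<tau>_def intro: inj_on_inv_into)
  have chart: "(U' \<times> ?T, map_prod \<eta> \<tau>) \<in> prod_atlas \<A>\<^sub>M torus_atlas"
    unfolding prod_atlas_def torus_atlas_def \<tau>_def using U'(1) B by blast
  define O' where "O' = (U \<times> UNIV) \<inter> (U' \<times> ?T) \<inter> \<theta> -` W"
  define F where "F = \<phi> \<circ> \<theta> \<circ> inv_into (U' \<times> ?T) (map_prod \<eta> \<tau>)"
  define D where "D = map_prod \<eta> \<tau> ` O'"
  have "c1_on F D" using c1' chart W unfolding c1_map_on_def F_def D_def O'_def by fast
  then have diffF: "F differentiable at p" if "p \<in> D" for p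
    using that unfolding c1_on_def differentiable_def by blast
  have F: "F (map_prod \<eta> \<tau> q) = \<phi> (\<theta> q)" if "q \<in> O'" for q
    using that inj_chart unfolding F_def O'_def by (simp add: inv_into_f_f)
  have "open O'"
  proof -
    have "open ((U \<times> UNIV) \<inter> \<theta> -` W)"
      using c1' U chartD(1)[OF \<Omega> W] unfolding c1_map_on_def
      by (intro continuous_open_preimage) (auto intro: open_Times)
    moreover have "open (U' \<times> ?T)" using chartD(1)[OF M U'(1)] B by (intro open_Times open_torus_proj_image) auto
    ultimately have "open (((U \<times> UNIV) \<inter> \<theta> -` W) \<inter> (U' \<times> ?T))" by (rule open_Int)
    then show ?thesis by (simp add: O'_def Int_ac)
  qed
  have D_open: "open D"
    unfolding D_def
  proof (rule open_image_map_prod[OF _ _ \<open>open O'\<close>])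
    show "open (\<eta> ` S)" if "open S" "S \<subseteq> U'" for S using chartD(4)[OF M U'(1)] that .
    show "open (\<tau> ` S)" if "open S" "S \<subseteq> ?T" for S
    proof -
      have "\<tau> ` S = B \<inter> torus_proj -` S"
      proof safe
        fix b assume "b \<in> B" "torus_proj b \<in> S"
        then show "b \<in> \<tau> ` S" using B(2) unfolding \<tau>_def by (metis imageI inv_into_f_f)
      qed (use \<tau> that(2) in auto)
      then show ?thesis using that(1) B(1) by (simp add: open_torus_def open_Int)
    qed
    show "O' \<subseteq> U' \<times> ?T" by (auto simp: O'_def)
  qed
  define G where "G = W \<inter> (\<pi> -` U \<inter> \<psi> -` (U' \<times> ?T))"
  have \<pi>U: "open (\<pi> -` U)" using \<pi> U by (simp add: continuous_on_open_vimage)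
  have mem: "\<psi> z \<in> O'" if "z \<in> G" for z
    using that fst[of z] \<theta>\<psi>[of z] unfolding G_def O'_def
    by (auto simp: mem_Times_iff)
  have "open G"
    using c1 \<pi>U chartD(1)[OF \<Omega> W] chartD(1)[OF M U'(1)] B unfolding G_def c1_map_on_def
    by (intro open_Int continuous_open_preimage) (auto intro!: open_Times open_torus_proj_image)
  moreover have zG: "z \<in> G"
  proof -
    have "snd (\<psi> z) \<in> ?T"
      by (rule image_eqI[of _ _ "rep_torus (snd (\<psi> z))"]) (auto simp: B_def)
    then show ?thesis using z U' fst[OF z(2)] by (simp add: G_def mem_Times_iff)
  qed
  moreover have "negligible (\<phi> ` (\<pi> -` S \<inter> W \<inter> G))"
  proof (rule negligible_subset)
    let ?N = "D \<inter> (\<eta> ` (S \<inter> U') \<times> UNIV)"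
    show "\<phi> ` (\<pi> -` S \<inter> W \<inter> G) \<subseteq> F ` ?N"
    proof safe
      fix x assume x: "x \<in> G" "\<pi> x \<in> S"
      then have "\<pi> x \<in> U" "\<pi> x \<in> U'" using fst[of x] by (auto simp: G_def mem_Times_iff)
      show "\<phi> x \<in> F ` ?N"
      proof (rule image_eqI[of _ _ "map_prod \<eta> \<tau> (\<psi> x)"])
        show "\<phi> x = F (map_prod \<eta> \<tau> (\<psi> x))" using F[OF mem[OF x(1)]] \<theta>\<psi>[OF \<open>\<pi> x \<in> U\<close>] by simp
        show "map_prod \<eta> \<tau> (\<psi> x) \<in> ?N"
          using mem[OF x(1)] x(2) \<open>\<pi> x \<in> U'\<close> fst[OF \<open>\<pi> x \<in> U\<close>] unfolding D_def
          by (auto simp: mem_Times_iff)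
      qed
    qed
    show "negligible (F ` ?N)"
    proof (rule negligible_differentiable_image_negligible)
      have "\<eta> ` (S \<inter> U') \<in> null_sets lebesgue" using S U'(1) by (auto simp: manifold_null_set_def)
      from negligible_Times_UNIV[OF this] show "negligible ?N" by (rule negligible_subset) auto
      show "F differentiable_on ?N"
        using diffF by (auto simp: differentiable_on_def intro: differentiable_at_withinI)
      show "DIM((real ^ 'n) \<times> (real ^ 'd)) \<le> DIM('e)"
      proof (rule invariance_of_dimension[OF _ D_open])
        show "continuous_on D F"
          by (intro continuous_at_imp_continuous_on ballI differentiable_imp_continuous_within diffF)
        show "inj_on F D"
        proof (rule inj_onI)
          fix p p' assume "p \<in> D" "p' \<in> D" "F p = F p'"
          obtain q where q: "q \<in> O'" "p = map_prod \<eta> \<tau> q"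
            using \<open>p \<in> D\<close> unfolding D_def by (elim imageE)
          obtain q' where q': "q' \<in> O'" "p' = map_prod \<eta> \<tau> q'"
            using \<open>p' \<in> D\<close> unfolding D_def by (elim imageE)
          have "\<phi> (\<theta> q) = \<phi> (\<theta> q')"
            using \<open>F p = F p'\<close> unfolding q(2) q'(2) F[OF q(1)] F[OF q'(1)] .
          then have "\<theta> q = \<theta> q'"
            using q(1) q'(1) unfolding O'_def by (intro inj_onD[OF chartD(3)[OF \<Omega> W]]) auto
          then have "q = q'"
            using q(1) q'(1) unfolding O'_def by (intro inj_onD[OF \<theta>_inj]) auto
          then show "p = p'" using q(2) q'(2) by simp
        qed
        show "D \<noteq> {}" using mem[OF zG] by (auto simp: D_def)
      qed
    qed
  qed
  ultimately show ?thesis by (rule that)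
qed

lemma manifold_null_set_vimage:
  fixes \<A>\<^sub>\<Omega> :: "('o::second_countable_topology, 'e::euclidean_space) chart set"
    and \<A>\<^sub>M :: "('m::topological_space, real ^ 'n) chart set"
    and \<T> :: "('o, 'm, 'd::finite) trivialization set"
  assumes \<Omega>: "c1_atlas \<A>\<^sub>\<Omega>" and M: "c1_atlas \<A>\<^sub>M" and \<pi>: "continuous_on UNIV \<pi>"
    and triv: "\<And>c. c \<in> \<T> \<Longrightarrow> local_trivialization \<A>\<^sub>\<Omega> \<A>\<^sub>M \<pi> c" and cover: "(\<Union>(U, \<psi>)\<in>\<T>. U) = UNIV"
    and S: "manifold_null_set \<A>\<^sub>M S"
  shows "manifold_null_set \<A>\<^sub>\<Omega> (\<pi> -` S)"
  unfolding manifold_null_set_def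
proof safe
  fix W \<phi> assume W: "(W, \<phi>) \<in> \<A>\<^sub>\<Omega>"
  let ?\<G> = "{G. open G \<and> negligible (\<phi> ` (\<pi> -` S \<inter> W \<inter> G))}"
  obtain \<G> where \<G>: "\<G> \<subseteq> ?\<G>" "countable \<G>" "\<Union>\<G> = \<Union>?\<G>"
    by (rule Lindelof[of ?\<G>]) auto
  have "W \<subseteq> \<Union>?\<G>"
  proof
    fix z assume "z \<in> W"
    obtain U \<psi> where "(U, \<psi>) \<in> \<T>" "\<pi> z \<in> U" using cover by fast
    then obtain G where "open G" "z \<in> G" "negligible (\<phi> ` (\<pi> -` S \<inter> W \<inter> G))"
      using manifold_null_set_vimage_local[OF \<Omega> M \<pi> triv S W \<open>z \<in> W\<close>] by blast
    then show "z \<in> \<Union>?\<G>" by blast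
  qed
  then have "\<phi> ` (\<pi> -` S \<inter> W) \<subseteq> (\<Union>G\<in>\<G>. \<phi> ` (\<pi> -` S \<inter> W \<inter> G))" using \<G>(3) by blast
  moreover have "negligible (\<Union>G\<in>\<G>. \<phi> ` (\<pi> -` S \<inter> W \<inter> G))"
    using \<G>(1,2) by (intro negligible_countable_Union) auto
  ultimately show "\<phi> ` (\<pi> -` S \<inter> W) \<in> null_sets lebesgue"
    using negligible_subset negligible_iff_null_sets by blast
qed

section \<open>Compatible flows in trivializations\<close>

text \<open>The structure behind measurability of the flow and invariance of \<open>\<mu>\<close>; nonresonance and absolute
  continuity are added in an extension of this locale.\<close>

locale kepler_system =
  fixes \<A>\<^sub>\<Omega> :: "('o::{t2_space, second_countable_topology}, 'e::euclidean_space) chart set"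
    and \<A>\<^sub>M :: "('m::{t2_space, second_countable_topology}, real ^ 'n) chart set"
    and \<pi> :: "'o \<Rightarrow> 'm"
    and \<T> :: "('o, 'm, 'd::finite) trivialization set"
    and g :: "real \<Rightarrow> 'o \<Rightarrow> 'o"
    and v :: "('o, 'm, 'd) trivialization \<Rightarrow> 'm \<Rightarrow> real ^ 'd"
    and \<mu> :: "'o measure"
  assumes tori_bundle: "affine_tori_bundle \<A>\<^sub>\<Omega> \<A>\<^sub>M \<pi> \<T>"
    and compatible: "compatible_flow \<A>\<^sub>M \<pi> \<T> g v"
    and probability: "prob_space \<mu>"
    and meas: "compatible_measure \<pi> \<T> \<mu>"
begin

lemma atlases: "c1_atlas \<A>\<^sub>\<Omega>" "c1_atlas \<A>\<^sub>M"
  and continuous_\<pi>: "continuous_on A \<pi>"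
  and trivialization: "c \<in> \<T> \<Longrightarrow> local_trivialization \<A>\<^sub>\<Omega> \<A>\<^sub>M \<pi> c"
  and cover: "(\<Union>(U, \<psi>)\<in>\<T>. U) = UNIV"
  using tori_bundle continuous_on_subset[of UNIV \<pi> A]
  by (simp_all add: affine_tori_bundle_def trivializing_atlas_def c1_map_on_def)

lemma sets_\<mu> [simp, measurable_cong]: "sets \<mu> = sets borel"
  using meas by (simp add: compatible_measure_def)

lemma space_\<mu> [simp]: "space \<mu> = UNIV"
  using sets_eq_imp_space_eq[OF sets_\<mu>] by simp

lemma \<pi>_Borel [measurable]: "\<pi> \<in> borel_measurable borel"
  by (rule borel_measurable_continuous_onI[OF continuous_\<pi>])

lemma trivialization_cover: "\<exists>U \<psi>. (U, \<psi>) \<in> \<T> \<and> x \<in> U"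
  using cover by fast

context
  fixes U :: "'m set" and \<psi> :: "'o \<Rightarrow> 'm \<times> 'd torus"
  assumes U\<psi>: "(U, \<psi>) \<in> \<T>"
begin

abbreviation "\<theta> \<equiv> inv_into (\<pi> -` U) \<psi>"
abbreviation "y\<^sub>\<psi> z \<equiv> snd (\<psi> z)"
abbreviation "v\<^sub>\<psi> \<equiv> v (U, \<psi>)"

lemma open_U: "open U"
  using trivialization[OF U\<psi>] by (auto simp: local_trivialization_def intro: chart_domain_open)

lemma open_over_U: "open (\<pi> -` U)"
  using continuous_\<pi>[of UNIV] open_U by (simp add: continuous_on_open_vimage)

lemma diffeo: "bij_betw \<psi> (\<pi> -` U) (U \<times> UNIV)" "continuous_on (\<pi> -` U) \<psi>" "continuous_on (U \<times> UNIV) \<theta>"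
  using trivialization[OF U\<psi>] by (auto simp: local_trivialization_def c1_diffeomorphism_def c1_map_on_def)

lemma \<psi>_eq: "\<pi> z \<in> U \<Longrightarrow> \<psi> z = (\<pi> z, y\<^sub>\<psi> z)"
  using trivialization[OF U\<psi>] by (auto simp: local_trivialization_def prod_eq_iff)

lemma \<theta>_\<psi>: "\<pi> z \<in> U \<Longrightarrow> \<theta> (\<pi> z, y\<^sub>\<psi> z) = z"
  using inv_into_f_f[OF bij_betw_imp_inj_on[OF diffeo(1)], of z] by (simp add: \<psi>_eq[symmetric])

lemma \<theta>: "x \<in> U \<Longrightarrow> \<psi> (\<theta> (x, y)) = (x, y)" "x \<in> U \<Longrightarrow> \<pi> (\<theta> (x, y)) = x"
proof -
  assume "x \<in> U"
  then have mem: "(x, y) \<in> \<psi> ` (\<pi> -` U)" using bij_betw_imp_surj_on[OF diffeo(1)] by simp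
  show 1: "\<psi> (\<theta> (x, y)) = (x, y)" using f_inv_into_f[OF mem] by simp
  have "\<theta> (x, y) \<in> \<pi> -` U" using inv_into_into[OF mem] by simp
  then show "\<pi> (\<theta> (x, y)) = x" using \<psi>_eq[of "\<theta> (x, y)"] 1 by simp
qed

text \<open>The flow rotates the fibres; in particular it stays over the same point of the base.\<close>

lemma flow_in_chart:
  assumes z: "\<pi> z \<in> U"
  shows "\<pi> (g t z) = \<pi> z" and "y\<^sub>\<psi> (g t z) = y\<^sub>\<psi> z + torus_proj (t *\<^sub>R v\<^sub>\<psi> (\<pi> z))"
    and "g t z = \<theta> (\<pi> z, y\<^sub>\<psi> z + torus_proj (t *\<^sub>R v\<^sub>\<psi> (\<pi> z)))"
proof -
  have inv: "g t ` (\<pi> -` U) \<subseteq> \<pi> -` U" and eq: "\<psi> (g t (\<theta> (x, y))) = (x, y + torus_proj (t *\<^sub>R v\<^sub>\<psi> x))"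
    if "x \<in> U" for x y
    using compatible U\<psi> that unfolding compatible_flow_def by fastforce+
  have U': "\<pi> (g t z) \<in> U" using inv[OF z] z by auto
  have "\<psi> (g t z) = (\<pi> z, y\<^sub>\<psi> z + torus_proj (t *\<^sub>R v\<^sub>\<psi> (\<pi> z)))"
    using eq[OF z, of "y\<^sub>\<psi> z"] by (simp only: \<theta>_\<psi>[OF z])
  then show 1: "\<pi> (g t z) = \<pi> z" and 2: "y\<^sub>\<psi> (g t z) = y\<^sub>\<psi> z + torus_proj (t *\<^sub>R v\<^sub>\<psi> (\<pi> z))"
    using \<psi>_eq[OF U'] by auto
  show "g t z = \<theta> (\<pi> z, y\<^sub>\<psi> z + torus_proj (t *\<^sub>R v\<^sub>\<psi> (\<pi> z)))"
    using \<theta>_\<psi>[OF U'] by (simp only: 1 2)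
qed

lemma continuous_v: "continuous_on U v\<^sub>\<psi>"
  using compatible U\<psi> unfolding compatible_flow_def c1_map_on_def by fastforce

lemma continuous_flow_over_U: "continuous_on (\<pi> -` U) (g t)"
proof -
  have "continuous_on (\<pi> -` U) (\<lambda>z. \<theta> (\<pi> z, (\<lambda>(y, s). y + torus_proj s) (y\<^sub>\<psi> z, t *\<^sub>R v\<^sub>\<psi> (\<pi> z))))"
    by (rule continuous_on_compose2[OF diffeo(3)], intro continuous_on_Pair continuous_\<pi>
        continuous_on_compose2[OF continuous_torus_translation] continuous_intros diffeo(2)
        continuous_on_compose2[OF continuous_v]) auto
  then show ?thesis by (rule continuous_on_cong[THEN iffD1, rotated -1]) (auto simp: flow_in_chart(3))
qed

lemma chart_image_Borel:
  assumes "A \<in> sets borel"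
  shows "{p \<in> U \<times> UNIV. \<theta> p \<in> A} \<in> sets borel"
  by (rule borel_preimage_continuous_on[OF diffeo(3) borel_open[OF open_Times[OF open_U open_UNIV]] assms])

lemma chart_coordinates_measurable:
  "\<psi> \<in> measurable (restrict_space \<mu> (\<pi> -` U)) (restrict_space borel U \<Otimes>\<^sub>M torus_lebesgue)"
proof -
  have s: "sets (restrict_space \<mu> (\<pi> -` U)) = sets (restrict_space borel (\<pi> -` U))"
    by (rule sets_restrict_space_cong) simp
  have "continuous_on (\<pi> -` U) y\<^sub>\<psi>" by (intro continuous_intros diffeo)
  then have "y\<^sub>\<psi> \<in> measurable (restrict_space \<mu> (\<pi> -` U)) torus_lebesgue"
    using borel_measurable_continuous_on_restrict by (simp add: measurable_cong_sets[OF s sets_torus_lebesgue])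
  moreover have "\<pi> \<in> measurable (restrict_space \<mu> (\<pi> -` U)) (restrict_space borel U)"
    by (rule measurable_restrict_space3) auto
  ultimately have "(\<lambda>z. (\<pi> z, y\<^sub>\<psi> z)) \<in> measurable (restrict_space \<mu> (\<pi> -` U)) (restrict_space borel U \<Otimes>\<^sub>M torus_lebesgue)"
    by (intro measurable_Pair)
  moreover have "\<psi> z = (\<pi> z, y\<^sub>\<psi> z)" if "z \<in> space (restrict_space \<mu> (\<pi> -` U))" for z
    using that by (intro \<psi>_eq) (simp add: space_restrict_space)
  ultimately show ?thesis by (simp cong: measurable_cong)
qed

text \<open>Fubini's theorem for the product form of \<open>\<mu>\<close> in a trivialization: the measure of a set is the
  integral of the measures of its fibres.\<close>

lemma emeasure_over_U:
  assumes A [measurable]: "A \<in> sets borel"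
  shows "emeasure \<mu> (A \<inter> \<pi> -` U)
    = (\<integral>\<^sup>+x. emeasure torus_lebesgue {y. \<theta> (x, y) \<in> A} \<partial>restrict_space (distr \<mu> borel \<pi>) U)"
proof -
  interpret torus: finite_measure "torus_lebesgue :: 'd torus measure" by (rule finite_measure_torus_lebesgue)
  let ?N = "restrict_space (distr \<mu> borel \<pi>) U"
  let ?R = "restrict_space borel U \<Otimes>\<^sub>M (torus_lebesgue :: 'd torus measure)"
  let ?E = "{p \<in> U \<times> UNIV. \<theta> p \<in> A}"
  have [simp]: "U \<inter> space borel \<in> sets borel" using open_U by simp
  have "(\<lambda>p. (fst p, snd p)) \<in> measurable ?R (borel \<Otimes>\<^sub>M borel)"
  proof (rule measurable_Pair)
    show "fst \<in> measurable ?R borel"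
      by (rule measurable_compose[OF measurable_fst measurable_restrict_space1]) simp
    show "snd \<in> measurable ?R borel"
      using measurable_snd[of "restrict_space borel U" "torus_lebesgue :: 'd torus measure"]
      by (simp cong: measurable_cong_sets)
  qed
  then have "(\<lambda>p. p) \<in> measurable ?R borel" by (simp add: borel_prod)
  from measurable_sets[OF this chart_image_Borel[OF A]]
  have "(\<lambda>p. p) -` ?E \<inter> space ?R \<in> sets ?R" .
  moreover have "(\<lambda>p. p) -` ?E \<inter> space ?R = ?E"
    by (auto simp: space_pair_measure space_restrict_space)
  ultimately have E: "?E \<in> sets ?R" by simp
  have sets_eq: "sets (?N \<Otimes>\<^sub>M (torus_lebesgue :: 'd torus measure)) = sets ?R"
    by (intro sets_pair_measure_cong sets_restrict_space_cong) auto
  have law: "distr (restrict_space \<mu> (\<pi> -` U)) ?R \<psi> = ?N \<Otimes>\<^sub>M torus_lebesgue"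
    using meas U\<psi> unfolding compatible_measure_def by fast
  have "A \<inter> \<pi> -` U = \<psi> -` ?E \<inter> (\<pi> -` U)"
    using \<theta>_\<psi> \<psi>_eq by (auto simp: mem_Times_iff) (metis fst_conv)+
  then have "emeasure \<mu> (A \<inter> \<pi> -` U) = emeasure (restrict_space \<mu> (\<pi> -` U)) (\<psi> -` ?E \<inter> (\<pi> -` U))"
    using open_over_U by (simp add: emeasure_restrict_space)
  also have "\<dots> = emeasure (distr (restrict_space \<mu> (\<pi> -` U)) ?R \<psi>) ?E"
    by (subst emeasure_distr[OF chart_coordinates_measurable E]) (simp add: space_restrict_space)
  also have "\<dots> = (\<integral>\<^sup>+x. emeasure torus_lebesgue (Pair x -` ?E) \<partial>?N)"
    unfolding law using E sets_eq by (intro torus.emeasure_pair_measure_alt) simp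
  also have "\<dots> = (\<integral>\<^sup>+x. emeasure torus_lebesgue {y. \<theta> (x, y) \<in> A} \<partial>?N)"
    by (intro nn_integral_cong arg_cong[of _ _ "emeasure torus_lebesgue"])
      (auto simp: space_restrict_space)
  finally show ?thesis .
qed

text \<open>The flow acts on each fibre by a translation of the torus.\<close>

lemma emeasure_flow_over_U:
  assumes A: "A \<in> sets borel" and gA: "g t -` A \<in> sets borel"
  shows "emeasure \<mu> (g t -` A \<inter> \<pi> -` U) = emeasure \<mu> (A \<inter> \<pi> -` U)"
  unfolding emeasure_over_U[OF A] emeasure_over_U[OF gA]
proof (rule nn_integral_cong)
  fix x assume "x \<in> space (restrict_space (distr \<mu> borel \<pi>) U)"
  then have x: "x \<in> U" by (simp add: space_restrict_space)
  let ?B = "{y. \<theta> (x, y) \<in> A}"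
  have "continuous_on UNIV (\<lambda>y. \<theta> (x, y))"
    using x by (intro continuous_on_compose2[OF diffeo(3)] continuous_intros) auto
  from borel_preimage_continuous_on[OF this _ A] have B: "?B \<in> sets borel" by simp
  have "g t (\<theta> (x, y)) = \<theta> (x, y + torus_proj (t *\<^sub>R v\<^sub>\<psi> x))" for y
    using flow_in_chart(3)[of "\<theta> (x, y)" t] by (simp only: \<theta>[OF x] x snd_conv simp_thms)
  then have "{y. \<theta> (x, y) \<in> g t -` A} = (\<lambda>y. y + torus_proj (t *\<^sub>R v\<^sub>\<psi> x)) -` ?B"
    by auto
  then show "emeasure torus_lebesgue {y. \<theta> (x, y) \<in> g t -` A} = emeasure torus_lebesgue ?B"
    using torus_lebesgue_translation_invariant[OF B] by simp
qed

lemma coordinate_function_Borel: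
  fixes G :: "'d torus \<Rightarrow> real"
  assumes [measurable]: "P \<in> sets borel" and P: "P \<subseteq> U" and [measurable]: "G \<in> borel_measurable borel"
  shows "(\<lambda>z. indicator P (\<pi> z) * G (y\<^sub>\<psi> z)) \<in> borel_measurable borel"
proof -
  have "continuous_on (\<pi> -` U) y\<^sub>\<psi>" by (intro continuous_intros diffeo)
  then have [measurable]: "y\<^sub>\<psi> \<in> borel_measurable (restrict_space borel (\<pi> -` U))"
    by (rule borel_measurable_continuous_on_restrict)
  have [measurable]: "\<pi> \<in> borel_measurable (restrict_space borel (\<pi> -` U))"
    by (rule measurable_restrict_space1) simp
  have "(\<lambda>z. indicator P (\<pi> z) * G (y\<^sub>\<psi> z)) \<in> borel_measurable (restrict_space borel (\<pi> -` U))"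
    by measurable
  then have "(\<lambda>z. indicator (\<pi> -` U) z *\<^sub>R (indicator P (\<pi> z) * G (y\<^sub>\<psi> z))) \<in> borel_measurable borel"
    using open_over_U by (subst (asm) borel_measurable_restrict_space_iff) auto
  moreover have "(\<lambda>z. indicator (\<pi> -` U) z *\<^sub>R (indicator P (\<pi> z) * G (y\<^sub>\<psi> z)))
      = (\<lambda>z. indicator P (\<pi> z) * G (y\<^sub>\<psi> z))"
    by (rule ext) (use P in \<open>auto simp: indicator_def\<close>)
  ultimately show ?thesis by simp
qed

end

lemma \<pi>_flow [simp]: "\<pi> (g t z) = \<pi> z"
  using trivialization_cover[of "\<pi> z"] flow_in_chart(1) by blast

lemma countable_trivializing_cover:
  obtains U :: "nat \<Rightarrow> 'm set" and \<psi> where "\<And>i. (U i, \<psi> i) \<in> \<T>" "(\<Union>i. U i) = UNIV"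
proof -
  obtain \<U> where \<U>: "\<U> \<subseteq> fst ` \<T>" "countable \<U>" "\<Union>\<U> = \<Union>(fst ` \<T>)"
    by (rule Lindelof[of "fst ` \<T>"]) (auto intro: open_U)
  then have "\<Union>\<U> = UNIV" using cover by (simp add: case_prod_beta')
  then have "\<U> \<noteq> {}" by auto
  then have range: "range (from_nat_into \<U>) = \<U>" using \<U>(2) by (rule range_from_nat_into)
  have "\<exists>\<psi>. (from_nat_into \<U> i, \<psi>) \<in> \<T>" for i
    using \<U>(1) from_nat_into[OF \<open>\<U> \<noteq> {}\<close>, of i] by fastforce
  then obtain \<psi> where "\<And>i. (from_nat_into \<U> i, \<psi> i) \<in> \<T>" by metis
  then show ?thesis using that[of "from_nat_into \<U>" \<psi>] range \<open>\<Union>\<U> = UNIV\<close> by simp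
qed

text \<open>Changes of trivialization mix base and fibre coordinates, so a Borel set is cut into pieces that
  each live over a single chart domain.\<close>

lemma countable_trivializing_partition:
  obtains P :: "nat \<Rightarrow> 'm set" and U \<psi> where "\<And>i. (U i, \<psi> i) \<in> \<T>" "\<And>i. P i \<subseteq> U i"
    "\<And>i. P i \<in> sets borel" "disjoint_family P" "(\<Union>i. P i) = UNIV"
proof -
  obtain U :: "nat \<Rightarrow> 'm set" and \<psi> where U: "\<And>i. (U i, \<psi> i) \<in> \<T>" "(\<Union>i. U i) = UNIV"
    by (rule countable_trivializing_cover) blast
  have "range (disjointed U) \<subseteq> sets borel"
    by (rule sets.range_disjointed_sets) (use U open_U in auto)
  with U show ?thesis
    by (intro that[of U \<psi> "disjointed U"]) (auto simp: disjointed_subset disjoint_family_disjointed UN_disjointed_eq)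
qed

lemma flow_Borel [measurable]: "g t \<in> borel_measurable borel"
proof -
  have "continuous_on (\<Union>c\<in>\<T>. \<pi> -` fst c) (g t)"
    by (rule continuous_on_open_UN) (auto intro: open_over_U continuous_flow_over_U)
  moreover have "(\<Union>c\<in>\<T>. \<pi> -` fst c) = UNIV" using trivialization_cover by fastforce
  ultimately show ?thesis by (metis borel_measurable_continuous_onI)
qed

lemma flow_preserves_measure: "preserves_measure \<mu> g"
  unfolding preserves_measure_def
proof (intro allI conjI)
  fix t
  show m: "g t \<in> measurable \<mu> \<mu>" by measurable
  show "distr \<mu> \<mu> (g t) = \<mu>"
  proof (rule measure_eqI)
    fix A assume "A \<in> sets (distr \<mu> \<mu> (g t))"
    then have A [measurable]: "A \<in> sets borel" by simp
    obtain P :: "nat \<Rightarrow> 'm set" and U \<psi> where U: "\<And>i. (U i, \<psi> i) \<in> \<T>" and P: "\<And>i. P i \<subseteq> U i"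
      "\<And>i. P i \<in> sets borel" "disjoint_family P" "(\<Union>i. P i) = UNIV"
      by (rule countable_trivializing_partition) blast
    note [measurable] = P(2)
    have covered: "\<exists>i. x \<in> P i" for x using P(4) by blast
    define B where "B i = A \<inter> \<pi> -` P i" for i
    have B: "B i \<in> sets borel" for i
      unfolding B_def using measurable_sets[OF \<pi>_Borel P(2)] by auto
    have gB: "g t -` B i \<in> sets borel" for i
      using measurable_sets[OF flow_Borel B] by simp
    have piece: "emeasure \<mu> (g t -` B i) = emeasure \<mu> (B i)" for i
    proof -
      have "g t -` B i \<inter> \<pi> -` U i = g t -` B i" "B i \<inter> \<pi> -` U i = B i"
        using P(1)[of i] by (auto simp: B_def)
      then show ?thesis using emeasure_flow_over_U[OF U[of i] B[of i] gB[of i]] by simp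
    qed
    have disj: "disjoint_family B" "disjoint_family (\<lambda>i. g t -` B i)"
      using P(3) unfolding B_def disjoint_family_on_def by blast+
    have "emeasure (distr \<mu> \<mu> (g t)) A = emeasure \<mu> (\<Union>i. g t -` B i)"
    proof -
      have "g t -` A = (\<Union>i. g t -` B i)" using covered by (auto simp: B_def)
      then show ?thesis by (simp add: emeasure_distr[OF m])
    qed
    also have "\<dots> = (\<Sum>i. emeasure \<mu> (g t -` B i))"
      using gB disj by (intro suminf_emeasure[symmetric]) auto
    also have "\<dots> = (\<Sum>i. emeasure \<mu> (B i))" by (simp add: piece)
    also have "\<dots> = emeasure \<mu> (\<Union>i. B i)"
      using B disj by (intro suminf_emeasure) auto
    also have "(\<Union>i. B i) = A" using covered by (auto simp: B_def)
    finally show "emeasure (distr \<mu> \<mu> (g t)) A = emeasure \<mu> A" .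
  qed simp
qed

sublocale measure_preserving_flow \<mu> g
  using probability flow_preserves_measure compatible by (simp add: measure_preserving_flow_def measure_preserving_flow_axioms_def compatible_flow_def)

end

section \<open>Decay along nonresonant frequencies\<close>

locale nonresonant_kepler_system = kepler_system \<A>\<^sub>\<Omega> \<A>\<^sub>M \<pi> \<T> g v \<mu>
  for \<A>\<^sub>\<Omega> :: "('o::{t2_space, second_countable_topology}, 'e::euclidean_space) chart set"
    and \<A>\<^sub>M :: "('m::{t2_space, second_countable_topology}, real ^ 'n) chart set"
    and \<pi> :: "'o \<Rightarrow> 'm"
    and \<T> :: "('o, 'm, 'd::finite) trivialization set"
    and g :: "real \<Rightarrow> 'o \<Rightarrow> 'o"
    and v :: "('o, 'm, 'd) trivialization \<Rightarrow> 'm \<Rightarrow> real ^ 'd"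
    and \<mu> :: "'o measure" +
  assumes ac: "manifold_absolutely_continuous \<A>\<^sub>\<Omega> \<mu>"
    and nonresonant: "manifold_null_set \<A>\<^sub>M (resonant_set \<A>\<^sub>M \<T> v)"
begin

context
  fixes U :: "'m set" and \<psi> :: "'o \<Rightarrow> 'm \<times> 'd torus"
  assumes U\<psi>: "(U, \<psi>) \<in> \<T>"
begin

text \<open>The law of the frequency \<open>\<langle>\<xi>, v\<rangle> \<circ> \<pi>\<close> is absolutely continuous.\<close>

lemma frequency_level_null:
  assumes \<xi>: "\<xi> \<noteq> 0" and N: "N \<in> null_sets lborel"
  shows "\<pi> -` {x \<in> U. of_int_vec \<xi> \<bullet> v (U, \<psi>) x \<in> N} \<in> null_sets \<mu>"
proof -
  let ?f = "\<lambda>x. of_int_vec \<xi> \<bullet> v (U, \<psi>) x"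
  have "manifold_null_set \<A>\<^sub>M {x \<in> U. ?f x \<in> N}"
  proof (rule manifold_null_set_level[OF atlases(2) open_U[OF U\<psi>] _ nonresonant _ N])
    fix V \<eta> assume V: "(V, \<eta>) \<in> \<A>\<^sub>M"
    have "c1_map_on \<A>\<^sub>M euclidean_atlas U (v (U, \<psi>))"
      using compatible U\<psi> unfolding compatible_flow_def by fast
    then have "c1_on (v (U, \<psi>) \<circ> inv_into V \<eta>) (\<eta> ` (U \<inter> V))"
      using V unfolding c1_map_on_def euclidean_atlas_def by fastforce
    from c1_on_inner[OF this] show "c1_on (?f \<circ> inv_into V \<eta>) (\<eta> ` (U \<inter> V))" by (simp add: comp_def)
  next
    show "x \<in> resonant_set \<A>\<^sub>M \<T> v" if "x \<in> U" "differential_vanishes \<A>\<^sub>M ?f x" for x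
      unfolding resonant_set_def using that \<xi> U\<psi> by blast
  qed
  then have null: "manifold_null_set \<A>\<^sub>\<Omega> (\<pi> -` {x \<in> U. ?f x \<in> N})"
    by (intro manifold_null_set_vimage[OF atlases continuous_\<pi> trivialization cover])
  have "continuous_on U ?f" by (intro continuous_intros continuous_v[OF U\<psi>])
  then have "{x \<in> U. ?f x \<in> N} \<in> sets borel"
    using N open_U[OF U\<psi>] by (intro borel_preimage_continuous_on) auto
  from measurable_sets[OF \<pi>_Borel this] have "\<pi> -` {x \<in> U. ?f x \<in> N} \<in> sets borel" by simp
  then show ?thesis using ac null unfolding manifold_absolutely_continuous_def by blast
qed

text \<open>The phase of the wave at time \<open>t\<close> is its initial phase plus \<open>2\<pi>t\<langle>\<xi>, v\<rangle>\<close>. The addition theorem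
  separates the two, after which the initial phase is absorbed into the integrable factor of an
  oscillatory integral in the frequency; the weak limit is \<open>0\<close>.\<close>

lemma relaxes_wave:
  assumes P: "P \<in> sets borel" "P \<subseteq> U" and \<xi>: "\<xi> \<noteq> 0"
  shows "relaxes (\<lambda>z. indicator P (\<pi> z) * torus_wave \<xi> c (snd (\<psi> z)))"
proof -
  let ?F = "\<lambda>c z. indicator P (\<pi> z) * torus_wave \<xi> c (snd (\<psi> z)) :: real"
  let ?w = "\<lambda>x. of_int_vec \<xi> \<bullet> v (U, \<psi>) x"
  define W where "W z = indicator U (\<pi> z) * ?w (\<pi> z)" for z
  have F_Borel [measurable]: "?F c \<in> borel_measurable \<mu>" for c
    using coordinate_function_Borel[OF U\<psi> P torus_wave_Borel, of \<xi> c]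
    by (simp cong: measurable_cong_sets)
  have F1: "\<bar>?F c z\<bar> \<le> 1" for c z
    using torus_wave_bounded[of \<xi> c "snd (\<psi> z)"] by (simp split: split_indicator)
  have F_L2: "?F c \<in> L2 \<mu>" for c by (rule L2_bounded[OF F_Borel F1])
  have W_Borel [measurable]: "W \<in> borel_measurable \<mu>"
  proof -
    have "continuous_on U ?w" by (intro continuous_intros continuous_v[OF U\<psi>])
    then have "?w \<in> borel_measurable (restrict_space borel U)"
      by (rule borel_measurable_continuous_on_restrict)
    then have "(\<lambda>x. indicator U x *\<^sub>R ?w x) \<in> borel_measurable borel"
      using open_U[OF U\<psi>] by (subst (asm) borel_measurable_restrict_space_iff) auto
    from measurable_compose[OF \<pi>_Borel this] show ?thesis
      by (simp add: W_def[abs_def] cong: measurable_cong_sets)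
  qed
  have osc: "oscillation_vanishes \<mu> W (\<lambda>z. ?F c z * h z)" if h: "h \<in> L2 \<mu>" for c h
  proof (rule Riemann_Lebesgue_absolutely_continuous[OF L2_mult_integrable[OF F_L2 h] W_Borel])
    fix N :: "real set" assume "N \<in> null_sets lborel"
    from AE_not_in[OF frequency_level_null[OF \<xi> this]]
    show "AE z in \<mu>. W z \<in> N \<longrightarrow> ?F c z * h z = 0"
      by eventually_elim (use P(2) in \<open>auto simp: W_def split: split_indicator\<close>)
  qed
  \<comment> \<open>\<open>cos (\<beta> + s) = cos \<beta> cos s + sin \<beta> cos (s + \<pi>/2)\<close>, the sine being the wave with phase \<open>c - \<pi>/2\<close>\<close>
  have evolve: "?F c (g t z) = ?F c z * cos ((2 * pi * t) * W z) + ?F (c - pi/2) z * cos ((2 * pi * t) * W z + pi/2)"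
    for t z
  proof (cases "\<pi> z \<in> P")
    case True
    then have z: "\<pi> z \<in> U" using P(2) by blast
    define \<beta> where "\<beta> = 2 * pi * (of_int_vec \<xi> \<bullet> rep_torus (snd (\<psi> z))) + c"
    have "?F c (g t z) = cos (\<beta> + (2 * pi * t) * W z)"
      using True z by (simp add: flow_in_chart(2)[OF U\<psi> z] torus_wave_translate)
        (simp add: torus_wave_def W_def \<beta>_def algebra_simps)
    moreover have "?F c z = cos \<beta>" using True by (simp add: torus_wave_def \<beta>_def)
    moreover have "?F (c - pi/2) z = cos (\<beta> - pi/2)"
      using True by (simp add: torus_wave_def \<beta>_def add_diff_eq)
    moreover have "cos (\<beta> - pi/2) = sin \<beta>" by (simp add: cos_diff)
    ultimately show ?thesis by (simp add: cos_add)
  qed simp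
  show ?thesis
  proof (rule relaxesI[OF F_L2, of "\<lambda>_. 0"])
    fix h assume h: "h \<in> L2 \<mu>"
    have int: "integrable \<mu> (\<lambda>z. ?F c z * h z * cos (s * W z + d))" for c s d
      by (intro integrable_mult_cos L2_mult_integrable F_L2 h) measurable
    have eq: "(\<integral>z. ?F c (g t z) * h z \<partial>\<mu>)
        = (\<integral>z. ?F c z * h z * cos ((2 * pi * t) * W z + 0) \<partial>\<mu>)
          + (\<integral>z. ?F (c - pi/2) z * h z * cos ((2 * pi * t) * W z + pi/2) \<partial>\<mu>)" for t
    proof -
      have "(\<integral>z. ?F c (g t z) * h z \<partial>\<mu>) = (\<integral>z. ?F c z * h z * cos ((2 * pi * t) * W z + 0)
          + ?F (c - pi/2) z * h z * cos ((2 * pi * t) * W z + pi/2) \<partial>\<mu>)"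
        unfolding evolve by (simp add: algebra_simps)
      also have "\<dots> = (\<integral>z. ?F c z * h z * cos ((2 * pi * t) * W z + 0) \<partial>\<mu>)
          + (\<integral>z. ?F (c - pi/2) z * h z * cos ((2 * pi * t) * W z + pi/2) \<partial>\<mu>)"
        by (rule Bochner_Integration.integral_add[OF int int])
      finally show ?thesis .
    qed
    have scale: "filterlim (\<lambda>t. 2 * pi * t) at_top at_top"
      by (rule filterlim_tendsto_pos_mult_at_top[OF tendsto_const _ filterlim_ident]) simp
    have lim: "((\<lambda>t. \<integral>z. ?F c z * h z * cos ((2 * pi * t) * W z + d) \<partial>\<mu>) \<longlongrightarrow> 0) at_top" for c d
      using osc[OF h, of c] filterlim_compose[OF _ scale] unfolding oscillation_vanishes_def by blast
    from tendsto_add[OF lim lim, of c 0 "c - pi/2" "pi/2"]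
    show "((\<lambda>t. \<integral>z. ?F c (g t z) * h z \<partial>\<mu>) \<longlongrightarrow> (\<integral>z. 0 * h z \<partial>\<mu>)) at_top"
      unfolding eq by simp
  qed (auto simp: L2_def)
qed

text \<open>The case \<open>\<xi> = 0\<close>: functions of the base point alone are invariant under the flow.\<close>

lemma relaxes_base_indicator:
  assumes P [measurable]: "P \<in> sets borel"
  shows "relaxes (\<lambda>z. a * indicator P (\<pi> z))"
proof (rule relaxesI)
  have "(\<lambda>z. a * indicator P (\<pi> z)) \<in> borel_measurable \<mu>"
    by measurable
  then show L2: "(\<lambda>z. a * indicator P (\<pi> z)) \<in> L2 \<mu>"
    by (rule L2_bounded[of _ "\<bar>a\<bar>"]) (simp split: split_indicator)
  then show "(\<lambda>z. a * indicator P (\<pi> z)) \<in> L2 \<mu>" .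
  have "\<pi> -` P \<in> sets invariants"
    using measurable_sets[OF \<pi>_Borel P] by (simp add: sets_invariant_algebra)
  then have "(\<lambda>z. a * indicator (\<pi> -` P) z) \<in> borel_measurable invariants"
    by (intro borel_measurable_times borel_measurable_const borel_measurable_indicator)
  then show "(\<lambda>z. a * indicator P (\<pi> z)) \<in> borel_measurable invariants"
    by (simp add: indicator_def)
qed simp

lemma relaxes_trig_poly:
  assumes "trig_poly p" and P: "P \<in> sets borel" "P \<subseteq> U"
  shows "relaxes (\<lambda>z. indicator P (\<pi> z) * p (snd (\<psi> z)))"
  using assms(1)
proof induction
  case (wave a \<xi> c)
  show ?case
  proof (cases "\<xi> = 0")
    case True
    then show ?thesis
      using relaxes_base_indicator[OF P(1), of "a * cos c"]
      by (simp add: torus_wave_def of_int_vec_simps mult.commute)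
  next
    case False
    from relaxes_scale[OF relaxes_wave[OF P False], of a c]
    show ?thesis by (simp add: mult.left_commute)
  qed
qed (simp add: distrib_left relaxes_add)

lemma relaxes_box:
  assumes P: "P \<in> sets borel" "P \<subseteq> U" and B: "open B"
  shows "relaxes (\<lambda>z. indicator P (\<pi> z) * indicator B (snd (\<psi> z)))"
proof -
  obtain p where p: "\<And>n::nat. trig_poly (p n)" "\<And>n y. \<bar>p n y\<bar> \<le> 2"
    "\<And>y. (\<lambda>n. p n y) \<longlonglongrightarrow> indicator B y"
    using trig_poly_approximates_open[OF B] by blast
  show ?thesis
  proof (rule relaxes_dominated_limit)
    show "(\<lambda>_. 2) \<in> L2 \<mu>" by (rule L2_bounded[of _ 2]) auto
    show "relaxes (\<lambda>z. indicator P (\<pi> z) * p n (snd (\<psi> z)))" for n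
      by (rule relaxes_trig_poly[OF p(1) P])
    show "\<bar>indicator P (\<pi> z) * p n (snd (\<psi> z))\<bar> \<le> 2" for n z
      using p(2)[of n "snd (\<psi> z)"] by (simp split: split_indicator)
    show "(\<lambda>n. indicator P (\<pi> z) * p n (snd (\<psi> z))) \<longlonglongrightarrow> indicator P (\<pi> z) * indicator B (snd (\<psi> z))" for z
      by (intro tendsto_mult_left p)
  qed
qed

text \<open>Products of open sets generate the Borel sets of the product, and the sets treated here are
  closed under complements over \<open>U\<close> and under disjoint unions.\<close>

lemma relaxes_Borel_in_chart:
  assumes E: "E \<in> sets borel"
  shows "relaxes (indicator {z. \<pi> z \<in> U \<and> (\<pi> z, snd (\<psi> z)) \<in> E})"
proof -
  let ?G = "{A \<times> B |A B. open A \<and> open B} :: ('m \<times> 'd torus) set set"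
  let ?X = "\<lambda>E. {z. \<pi> z \<in> U \<and> (\<pi> z, snd (\<psi> z)) \<in> E}"
  have G: "Int_stable ?G"
  proof (rule Int_stableI, safe)
    fix A A' :: "'m set" and B B' :: "'d torus set"
    assume "open A" "open A'" "open B" "open B'"
    then show "\<exists>C D. A \<times> B \<inter> A' \<times> B' = C \<times> D \<and> open C \<and> open D"
      by (intro exI[of _ "A \<inter> A'"] exI[of _ "B \<inter> B'"]) (simp add: Times_Int_Times open_Int)
  qed
  have sub: "?G \<subseteq> Pow UNIV" by simp
  have "(borel :: ('m \<times> 'd torus) measure) = sigma UNIV ?G"
    by (rule second_countable_borel_measurable[OF open_prod_generated])
  from arg_cong[OF this, of sets]
  have "sets (borel :: ('m \<times> 'd torus) measure) = sigma_sets UNIV ?G"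
    unfolding sets_measure_of[OF sub] .
  with E have "E \<in> sigma_sets UNIV ?G" by blast
  from G sub this show ?thesis
  proof (rule sigma_sets_induct_disjoint[where P = "\<lambda>E. relaxes (indicator (?X E))"])
    fix R assume "R \<in> ?G"
    then obtain A B where R: "R = A \<times> B" "open A" "open B" by blast
    have "indicator (?X R) = (\<lambda>z. indicator (A \<inter> U) (\<pi> z) * indicator B (snd (\<psi> z)) :: real)"
      by (auto simp: R split: split_indicator)
    then show "relaxes (indicator (?X R))"
      using relaxes_box[of "A \<inter> U" B] R open_U[OF U\<psi>] by simp
  next
    show "relaxes (indicator (?X {}))" using relaxes_zero by (simp add: indicator_def[abs_def])
  next
    fix A assume "relaxes (indicator (?X A))"
    moreover have "relaxes (\<lambda>z. indicator U (\<pi> z))"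
      using relaxes_base_indicator[of U 1] open_U[OF U\<psi>] by simp
    ultimately have "relaxes (\<lambda>z. indicator U (\<pi> z) - indicator (?X A) z)" by (intro relaxes_diff)
    moreover have "(\<lambda>z. indicator U (\<pi> z) - indicator (?X A) z :: real) = indicator (?X (UNIV - A))"
      by (auto split: split_indicator)
    ultimately show "relaxes (indicator (?X (UNIV - A)))" by simp
  next
    fix A :: "nat \<Rightarrow> ('m \<times> 'd torus) set"
    assume A: "disjoint_family A" "\<And>i. relaxes (indicator (?X (A i)))"
    have "disjoint_family (\<lambda>i. ?X (A i))"
      using A(1) unfolding disjoint_family_on_def by blast
    from relaxes_disjoint_UN[OF this A(2)]
    show "relaxes (indicator (?X (\<Union>i. A i)))"
      by (rule back_subst[of "\<lambda>Y. relaxes (indicator Y)"]) auto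
  qed
qed

lemma relaxes_Borel_over_U:
  assumes A: "A \<in> sets borel" "A \<subseteq> \<pi> -` U"
  shows "relaxes (indicator A)"
proof -
  have "A = {z. \<pi> z \<in> U \<and> (\<pi> z, snd (\<psi> z)) \<in> {p \<in> U \<times> UNIV. inv_into (\<pi> -` U) \<psi> p \<in> A}}"
    using A(2) \<theta>_\<psi>[OF U\<psi>] by auto
  then show ?thesis using relaxes_Borel_in_chart[OF chart_image_Borel[OF U\<psi> A(1)]] by simp
qed

end

theorem exhibits_keplerian_shear: "keplerian_shear \<mu> g"
proof (rule keplerian_shearI)
  fix A assume "A \<in> sets \<mu>"
  then have A: "A \<in> sets borel" by simp
  obtain P :: "nat \<Rightarrow> 'm set" and U \<psi> where U: "\<And>i. (U i, \<psi> i) \<in> \<T>" and P: "\<And>i. P i \<subseteq> U i"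
    "\<And>i. P i \<in> sets borel" "disjoint_family P" "(\<Union>i. P i) = UNIV"
    by (rule countable_trivializing_partition) blast
  have "A \<inter> \<pi> -` P i \<in> sets borel" for i
    using A measurable_sets[OF \<pi>_Borel P(2)[of i]] by auto
  moreover have "A \<inter> \<pi> -` P i \<subseteq> \<pi> -` U i" for i using P(1)[of i] by auto
  ultimately have "relaxes (indicator (A \<inter> \<pi> -` P i))" for i
    by (rule relaxes_Borel_over_U[OF U])
  moreover have "disjoint_family (\<lambda>i. A \<inter> \<pi> -` P i)"
    using P(3) unfolding disjoint_family_on_def by blast
  ultimately have "relaxes (indicator (\<Union>i. A \<inter> \<pi> -` P i))" by (intro relaxes_disjoint_UN)
  moreover have "(\<Union>i. A \<inter> \<pi> -` P i) = A"
  proof -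
    have "\<exists>i. x \<in> P i" for x using P(4) by blast
    then show ?thesis by auto
  qed
  ultimately show "relaxes (indicator A)" by simp
qed

end

section \<open>Keplerian shear\<close>

theorem theorem2p3:
  fixes \<A>\<^sub>\<Omega> :: "('o::{t2_space, second_countable_topology}, 'e::euclidean_space) chart set"
    and \<A>\<^sub>M :: "('m::{t2_space, second_countable_topology}, real ^ 'n) chart set"
    and \<pi> :: "'o \<Rightarrow> 'm"
    and \<T> :: "('o, 'm, 'd::finite) trivialization set"
    and g :: "real \<Rightarrow> 'o \<Rightarrow> 'o"
    and v :: "('o, 'm, 'd) trivialization \<Rightarrow> 'm \<Rightarrow> real ^ 'd"
    and \<mu> :: "'o measure"
  assumes "affine_tori_bundle \<A>\<^sub>\<Omega> \<A>\<^sub>M \<pi> \<T>"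
    and "compatible_flow \<A>\<^sub>M \<pi> \<T> g v"
    and "prob_space \<mu>"
    and "compatible_measure \<pi> \<T> \<mu>"
    and "manifold_absolutely_continuous \<A>\<^sub>\<Omega> \<mu>"
    and "manifold_null_set \<A>\<^sub>M (resonant_set \<A>\<^sub>M \<T> v)"
  shows "keplerian_shear \<mu> g"
proof -
  interpret nonresonant_kepler_system \<A>\<^sub>\<Omega> \<A>\<^sub>M \<pi> \<T> g v \<mu>
    using assms
    by (intro nonresonant_kepler_system.intro kepler_system.intro nonresonant_kepler_system_axioms.intro)
  show ?thesis by (rule exhibits_keplerian_shear)
qed

end
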